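(* Suppose that $\varphi$ satisfies $(\varphi_1)$, $(\varphi_2)$, $(\varphi_3)$ (stated in the context). Let $\Psi$ be an $N$-function such that $\Psi<<\Phi_*$ and $$\lim_{|t|\to0}\frac{\Psi(t)}{\Phi(t)}=0.$$ Let $(u_n)$ be a bounded sequence in $W^{s,\Phi}(\mathbb{R}^N)$ such that $u_n\rightharpoonup0$ weakly in $X$ and $$\lim_{n\to+\infty}\left[\sup_{y\in\mathbb{R}^N}\int_{B_r(y)}\Phi(u_n)\,dx\right]=0$$ for some $r>0$, where $B_r(y)$ is the ball of radius $r$ centred at $y$. Then $u_n\to0$ in $L_\Psi(\mathbb{R}^N)$.
   Context: Let $N>2s$ with $N$ a positive integer and $0<s<1$. Let $\varphi:\mathbb{R}\to\mathbb{R}$ be a $C^1$ function such that $\Phi(t)=\int_0^t \tau\varphi(\tau)\,d\tau$ defines an even function $\Phi:\mathbb{R}\to\mathbb{R}$. Conditions on $\varphi$: $(\varphi_1)$ $t\varphi(t)\to 0$ as $t\to 0$ and $t\varphi(t)\to\infty$ as $t\to\infty$; $(\varphi_2)$ $t\varphi(t)$ is strictly increasing in $(0,\infty)$; $(\varphi_3)$ there exist $\ell,m\in(1,N)$ such that $\ell\le \frac{t^2\varphi(t)}{\Phi(t)}\le m<\ell^*$ for all $t>0$, where $\ell^*:=\frac{\ell N}{N-\ell}$. An $N$-function is a convex, continuous, even $A:\mathbb{R}\to[0,\infty)$ with $\lim_{t\to0}A(t)/t=0$, $\lim_{t\to\infty}A(t)/t=\infty$, and $A(t)>0$ for $t>0$.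 Write $A<<B$ if for each $a>0$ there is $x_a\ge0$ with $A(x)\le B(ax)$ for all $x\ge x_a$. The critical function $\Phi_*$ is the $N$-function whose inverse on $[0,\infty)$ is $\Phi_*^{-1}(t)=\int_0^t\frac{\Phi^{-1}(\tau)}{\tau^{(N+s)/N}}\,d\tau$. Spaces: for an $N$-function $A$, $L_A(\mathbb{R}^N)$ is the set of measurable $u:\mathbb{R}^N\to\mathbb{R}$ with $\int_{\mathbb{R}^N}A(|u|)\,dx<\infty$, with the Luxemburg norm $\|u\|_A=\inf\{\lambda>0:\int_{\mathbb{R}^N}A(|u|/\lambda)\,dx\le1\}$. Put $D_su(x,y)=\frac{u(x)-u(y)}{|x-y|^s}$ and $d\mu(x,y)=\frac{dx\,dy}{|x-y|^N}$. $W^{s,\Phi}(\mathbb{R}^N)$ is the set of $u\in L_\Phi(\mathbb{R}^N)$ with $\iint_{\mathbb{R}^N\times\mathbb{R}^N}\Phi(|D_su|)\,d\mu<\infty$, with norm $\|u\|_\Phi+[u]_{s,\Phi}$, where $[u]_{s,\Phi}=\inf\{\lambda>0:\iint\Phi(|D_su|/\lambda)\,d\mu\le1\}$. For a measurable potential $V:\mathbb{R}^N\to[0,\infty)$, $X=\{u\in W^{s,\Phi}(\mathbb{R}^N):\int_{\mathbb{R}^N} V(x)\Phi(|u|)\,dx<+\infty\}$ with norm $\|u\|=[u]_{s,\Phi}+\|u\|_{V,\Phi}$, where $\|u\|_{V,\Phi}=\inf\{\lambda>0:\int_{\mathbb{R}^N}V(x)\Phi(u/\lambda)\,dx\le1\}$.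 *)

theory Defs
  imports "HOL-Analysis.Analysis"
begin

definition Phi :: "(real \<Rightarrow> real) \<Rightarrow> real \<Rightarrow> real" where
  "Phi \<phi> t = (LBINT \<tau>=0..ereal t. \<tau> * \<phi> \<tau>)"

definition phi_1 :: "(real \<Rightarrow> real) \<Rightarrow> bool" where
  "phi_1 \<phi> \<longleftrightarrow>
     ((\<lambda>t. t * \<phi> t) \<longlongrightarrow> 0) (at 0) \<and> filterlim (\<lambda>t. t * \<phi> t) at_top at_top"

definition phi_2 :: "(real \<Rightarrow> real) \<Rightarrow> bool" where
  "phi_2 \<phi> \<longleftrightarrow> strict_mono_on {0<..} (\<lambda>t. t * \<phi> t)"

definition phi_3 :: "nat \<Rightarrow> (real \<Rightarrow> real) \<Rightarrow> bool" where
  "phi_3 N \<phi> \<longleftrightarrow>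
     (\<exists>l m. l \<in> {1<..<real N} \<and> m \<in> {1<..<real N} \<and>
        (\<forall>t>0. l \<le> t\<^sup>2 * \<phi> t / Phi \<phi> t \<and> t\<^sup>2 * \<phi> t / Phi \<phi> t \<le> m) \<and>
        m < l * real N / (real N - l))"

definition N_function :: "(real \<Rightarrow> real) \<Rightarrow> bool" where
  "N_function A \<longleftrightarrow>
     (\<forall>t. 0 \<le> A t) \<and> convex_on UNIV A \<and> continuous_on UNIV A \<and> (\<forall>t. A (- t) = A t) \<and>
     ((\<lambda>t. A t / t) \<longlongrightarrow> 0) (at 0) \<and> filterlim (\<lambda>t. A t / t) at_top at_top \<and>
     (\<forall>t>0. 0 < A t)"

definition grows_essentially_slower :: "(real \<Rightarrow> real) \<Rightarrow> (real \<Rightarrow> real) \<Rightarrow> bool" where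
  "grows_essentially_slower A B \<longleftrightarrow> (\<forall>a>0. \<exists>x0\<ge>0. \<forall>x\<ge>x0. A x \<le> B (a * x))"

definition critical_inv :: "nat \<Rightarrow> real \<Rightarrow> (real \<Rightarrow> real) \<Rightarrow> real \<Rightarrow> real" where
  "critical_inv N s P t =
     (LBINT \<tau>=0..ereal t. the_inv_into {0..} P \<tau> / \<tau> powr ((real N + s) / real N))"

text \<open>The critical function is the even extension of the inverse of \<open>critical_inv\<close> on
  \<open>[0, \<infinity>)\<close>.\<close>

definition critical_function :: "nat \<Rightarrow> real \<Rightarrow> (real \<Rightarrow> real) \<Rightarrow> real \<Rightarrow> real" where
  "critical_function N s P t = the_inv_into {0..} (critical_inv N s P) \<bar>t\<bar>"

text \<open>Below, function spaces are sets of functions rather than of almost-everywhere classes, and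
  the Luxemburg infima are taken in the reals, so they are meaningful only for
  functions for which some \<open>k > 0\<close> is admissible.\<close>

definition L_space :: "(real \<Rightarrow> real) \<Rightarrow> (real^'n \<Rightarrow> real) set" where
  "L_space A = {u \<in> borel_measurable lebesgue.
     (\<integral>\<^sup>+x. ennreal (A \<bar>u x\<bar>) \<partial>lebesgue) < \<infinity>}"

definition L_norm :: "(real \<Rightarrow> real) \<Rightarrow> (real^'n \<Rightarrow> real) \<Rightarrow> real" where
  "L_norm A u = Inf {k. 0 < k \<and> (\<integral>\<^sup>+x. ennreal (A (\<bar>u x\<bar> / k)) \<partial>lebesgue) \<le> 1}"

text \<open>On the diagonal, which is a null set, both the quotient \<open>D_quot\<close> and the density of
  \<open>mu\<close> take the value 0, because division by zero yields 0.\<close>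

definition D_quot :: "real \<Rightarrow> (real^'n \<Rightarrow> real) \<Rightarrow> (real^'n) \<times> (real^'n) \<Rightarrow> real" where
  "D_quot s u = (\<lambda>(x, y). (u x - u y) / norm (x - y) powr s)"

definition mu :: "((real^'n) \<times> (real^'n)) measure" where
  "mu = density (lebesgue \<Otimes>\<^sub>M lebesgue) (\<lambda>(x, y). ennreal (1 / norm (x - y) ^ CARD('n)))"

definition W_space :: "real \<Rightarrow> (real \<Rightarrow> real) \<Rightarrow> (real^'n \<Rightarrow> real) set" where
  "W_space s P = {u \<in> L_space P. (\<integral>\<^sup>+z. ennreal (P \<bar>D_quot s u z\<bar>) \<partial>mu) < \<infinity>}"

definition W_seminorm :: "real \<Rightarrow> (real \<Rightarrow> real) \<Rightarrow> (real^'n \<Rightarrow> real) \<Rightarrow> real" where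
  "W_seminorm s P u =
     Inf {k. 0 < k \<and> (\<integral>\<^sup>+z. ennreal (P (\<bar>D_quot s u z\<bar> / k)) \<partial>mu) \<le> 1}"

definition W_norm :: "real \<Rightarrow> (real \<Rightarrow> real) \<Rightarrow> (real^'n \<Rightarrow> real) \<Rightarrow> real" where
  "W_norm s P u = L_norm P u + W_seminorm s P u"

definition X_space ::
    "real \<Rightarrow> (real \<Rightarrow> real) \<Rightarrow> (real^'n \<Rightarrow> real) \<Rightarrow> (real^'n \<Rightarrow> real) set" where
  "X_space s P V = {u \<in> W_space s P. (\<integral>\<^sup>+x. ennreal (V x * P \<bar>u x\<bar>) \<partial>lebesgue) < \<infinity>}"

definition V_norm :: "(real \<Rightarrow> real) \<Rightarrow> (real^'n \<Rightarrow> real) \<Rightarrow> (real^'n \<Rightarrow> real) \<Rightarrow> real" where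
  "V_norm P V u =
     Inf {k. 0 < k \<and> (\<integral>\<^sup>+x. ennreal (V x * P (u x / k)) \<partial>lebesgue) \<le> 1}"

definition X_norm ::
    "real \<Rightarrow> (real \<Rightarrow> real) \<Rightarrow> (real^'n \<Rightarrow> real) \<Rightarrow> (real^'n \<Rightarrow> real) \<Rightarrow> real" where
  "X_norm s P V u = W_seminorm s P u + V_norm P V u"

text \<open>Bounded linear functionals on a linear space \<open>S\<close> of functions with (semi)norm \<open>nrm\<close>. The
  bound forces them to agree on functions at distance 0, so for \<open>X_space\<close> they are exactly the
  elements of the dual of the space of almost-everywhere classes.\<close>

definition dual_on ::
    "('a \<Rightarrow> real) set \<Rightarrow> (('a \<Rightarrow> real) \<Rightarrow> real) \<Rightarrow> (('a \<Rightarrow> real) \<Rightarrow> real) set" where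
  "dual_on S nrm = {f.
     (\<forall>u\<in>S. \<forall>v\<in>S. f (\<lambda>x. u x + v x) = f u + f v) \<and>
     (\<forall>c. \<forall>u\<in>S. f (\<lambda>x. c * u x) = c * f u) \<and>
     (\<exists>C. \<forall>u\<in>S. \<bar>f u\<bar> \<le> C * nrm u)}"

definition weakly_converges_on ::
    "('a \<Rightarrow> real) set \<Rightarrow> (('a \<Rightarrow> real) \<Rightarrow> real) \<Rightarrow> (nat \<Rightarrow> 'a \<Rightarrow> real) \<Rightarrow> ('a \<Rightarrow> real) \<Rightarrow> bool"
  where
  "weakly_converges_on S nrm u v \<longleftrightarrow>
     (\<forall>n. u n \<in> S) \<and> v \<in> S \<and> (\<forall>f\<in>dual_on S nrm. (\<lambda>n. f (u n)) \<longlonglongrightarrow> f v)"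

end

theory Submission
  imports Defs
begin

text \<open>
  Normalise to \<open>w = u / K\<close> with both modulars at most 1 and let \<open>J x\<close> be the inner integral of the
  Gagliardo modular, so that \<open>J\<close> has integral at most 1. If \<open>w\<close> differs from \<open>w x\<close> by at least \<open>\<tau>\<close>
  on half of the ball of radius \<open>\<rho>\<close> about \<open>x\<close>, then \<open>J x\<close> is at least a constant times
  \<open>\<Phi> (\<tau> / \<rho> powr s)\<close>. This elementary estimate replaces the Sobolev embedding in two places.

  With small balls, the vanishing hypothesis makes the sublevel set \<open>\<bar>w\<bar> \<le> \<delta> / 2\<close> fill half of every such
  ball, so \<open>J\<close> is huge on \<open>\<bar>w\<bar> > \<delta>\<close> and the measure of that set tends to 0. With balls whose
  volume is comparable to that of \<open>\<bar>w\<bar> > 2 ^ k\<close>, induction on \<open>k\<close> gives a weak-type bound on the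
  level sets in terms of \<open>\<Phi>\<^sub>*\<close>; inserted once more into the estimate, it yields the pointwise bound
  \<open>\<Phi>\<^sub>* (a * \<bar>w x\<bar>) \<le> C * a * J x\<close> where \<open>\<bar>w x\<bar> > 2\<close> and \<open>a \<le> 1 / 8\<close>. Now \<open>\<Psi>\<close> is controlled by \<open>\<Phi>\<close> for small
  values of \<open>\<bar>w\<bar>\<close>, by the measure of \<open>\<bar>w\<bar> > \<delta>\<close> for intermediate ones and by \<open>\<Phi>\<^sub>*\<close> for large ones.
  The function \<open>\<Phi>\<^sub>*\<close> enters only through the fact that \<open>v = \<Phi>\<^sub>* x\<close> satisfies
  \<open>v \<le> 2 * \<Phi> (2 * x * v powr (s / N))\<close>.
\<close>

subsection \<open>Functions between linear and power growth\<close>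

text \<open>\<open>upper\<close> is a quantitative doubling condition and \<open>lower\<close> takes
  the place of convexity; they are the integrated form of 1 \<le> t \<Phi>'(t) / \<Phi>(t) \<le>
  m.\<close>

locale growth_function =
  fixes \<Phi> :: "real \<Rightarrow> real" and m :: real
  assumes zero: "\<Phi> 0 = 0"
    and symmetric: "\<Phi> (- t) = \<Phi> t"
    and pos: "0 < t \<Longrightarrow> 0 < \<Phi> t"
    and cont: "continuous_on UNIV \<Phi>"
    and upper: "1 \<le> c \<Longrightarrow> 0 \<le> t \<Longrightarrow> \<Phi> (c * t) \<le> c powr m * \<Phi> t"
    and lower: "1 \<le> c \<Longrightarrow> 0 \<le> t \<Longrightarrow> c * \<Phi> t \<le> \<Phi> (c * t)"
    and m_pos: "0 < m"
begin

lemma abs_eq [simp]: "\<Phi> \<bar>t\<bar> = \<Phi> t"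
  by (metis abs_if symmetric)

lemma nonneg [simp]: "0 \<le> \<Phi> t"
  by (metis abs_eq abs_ge_zero less_eq_real_def pos zero)

lemma strict_increasing: "0 \<le> x \<Longrightarrow> x < y \<Longrightarrow> \<Phi> x < \<Phi> y"
proof -
  assume xy: "0 \<le> x" "x < y"
  show ?thesis
  proof (cases "x = 0")
    case True
    then show ?thesis using xy pos zero by simp
  next
    case False
    then have x: "0 < x" using xy by simp
    have "\<Phi> x * 1 < \<Phi> x * (y / x)"
      using xy x pos[OF x] by (intro mult_strict_left_mono) auto
    also have "\<dots> \<le> \<Phi> y"
      using lower[of "y / x" x] xy x by (simp add: mult.commute)
    finally show ?thesis by simp
  qed
qed

lemma increasing: "0 \<le> x \<Longrightarrow> x \<le> y \<Longrightarrow> \<Phi> x \<le> \<Phi> y"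
  using strict_increasing[of x y] by (cases "x = y") auto

lemma borel_measurable [measurable]: "\<Phi> \<in> borel_measurable borel"
  using cont by (rule borel_measurable_continuous_onI)

lemma upper_max: "0 \<le> c \<Longrightarrow> \<Phi> (c * t) \<le> max 1 c powr m * \<Phi> t"
proof -
  assume c: "0 \<le> c"
  have "\<Phi> (c * t) = \<Phi> (c * \<bar>t\<bar>)"
    using abs_eq[of "c * t"] c by (simp add: abs_mult)
  also have "\<dots> \<le> \<Phi> (max 1 c * \<bar>t\<bar>)"
    using c by (intro increasing mult_right_mono) auto
  also have "\<dots> \<le> max 1 c powr m * \<Phi> t"
    using upper[of "max 1 c" "\<bar>t\<bar>"] by simp
  finally show ?thesis .
qed

text \<open>This bound and the next are \<open>lower\<close> and \<open>upper\<close> read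
  backwards, from \<open>c * t\<close> up to \<open>t\<close> with factor
  \<open>1 / c\<close>.\<close>

lemma shrink: "0 \<le> c \<Longrightarrow> c \<le> 1 \<Longrightarrow> 0 \<le> t \<Longrightarrow> \<Phi> (c * t) \<le> c * \<Phi> t"
  using lower[of "1 / c" "c * t"] zero by (cases "c = 0") (auto simp: field_simps)

lemma shrink_powr: "0 \<le> c \<Longrightarrow> c \<le> 1 \<Longrightarrow> 0 \<le> t \<Longrightarrow> c powr m * \<Phi> t \<le> \<Phi> (c * t)"
  using upper[of "1 / c" "c * t"]
  by (cases "c = 0") (auto simp: powr_divide field_simps)

lemma unbounded: "1 \<le> t \<Longrightarrow> t * \<Phi> 1 \<le> \<Phi> t"
  using lower[of t 1] by simp

lemma bij: "bij_betw \<Phi> {0..} {0..}"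
  unfolding bij_betw_def
proof (intro conjI set_eqI iffI)
  show "inj_on \<Phi> {0..}"
    by (rule linorder_inj_onI') (use strict_increasing in force)
next
  fix y assume "y \<in> \<Phi> ` {0..}"
  then show "y \<in> {0..}" by auto
next
  fix y :: real assume y: "y \<in> {0..}"
  \<comment> \<open>Linear growth beyond 1 gives \<open>\<Phi> b\<close> \<ge>
    \<open>b * \<Phi> 1\<close> \<ge> \<open>y\<close>, so the intermediate value theorem applies
    between 0 and \<open>b\<close>.\<close>
  define b where "b = max 1 (y / \<Phi> 1)"
  have "y \<le> b * \<Phi> 1"
    using pos[of 1] by (simp add: b_def max_def field_simps)
  also have "\<dots> \<le> \<Phi> b" by (rule unbounded) (simp add: b_def)
  finally have "y \<le> \<Phi> b" .
  moreover have "0 \<le> b" by (simp add: b_def)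
  ultimately obtain x where "0 \<le> x" "x \<le> b" "\<Phi> x = y"
    using IVT'[of \<Phi> 0 y b] y zero cont continuous_on_subset by fastforce
  then show "y \<in> \<Phi> ` {0..}" by auto
qed

text \<open>Uses the same \<open>the_inv_into\<close> term as \<open>critical_inv\<close>, so that
  the two integrals can later be identified by unfolding.\<close>

definition inverse_fun :: "real \<Rightarrow> real" where
  "inverse_fun = the_inv_into {0..} \<Phi>"

lemma apply_inverse [simp]: "0 \<le> y \<Longrightarrow> \<Phi> (inverse_fun y) = y"
  unfolding inverse_fun_def using bij
  by (intro f_the_inv_into_f) (auto simp: bij_betw_def)

lemma inverse_nonneg: "0 \<le> y \<Longrightarrow> 0 \<le> inverse_fun y"
  unfolding inverse_fun_def using bij the_inv_into_into[of \<Phi> "{0..}" y "{0..}"]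
  by (auto simp: bij_betw_def)

lemma inverse_mono: "0 \<le> x \<Longrightarrow> x \<le> y \<Longrightarrow> inverse_fun x \<le> inverse_fun y"
  using strict_increasing[of "inverse_fun y" "inverse_fun x"] apply_inverse[of x] apply_inverse[of y]
    inverse_nonneg[of y] by linarith

lemma inverse_pos: "0 < y \<Longrightarrow> 0 < inverse_fun y"
  using inverse_nonneg[of y] apply_inverse[of y] zero
  by (cases "inverse_fun y = 0") auto

text \<open>The growth bound \<open>upper\<close> inverted. It forces the inverse to decay at 0 at
  least like a power 1 / m, which makes the critical integrand integrable there.\<close>

lemma inverse_upper: "0 \<le> \<tau> \<Longrightarrow> \<tau> \<le> v \<Longrightarrow> inverse_fun \<tau> \<le> inverse_fun v * (\<tau> / v) powr (1 / m)"
proof -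
  assume h: "0 \<le> \<tau>" "\<tau> \<le> v"
  show ?thesis
  proof (cases "\<tau> = 0")
    case True
    then show ?thesis
      using strict_increasing[of 0 "inverse_fun 0"] apply_inverse[of 0] zero by force
  next
    case False
    then have p: "0 < \<tau>" "0 < v" using h by auto
    define S where "S = inverse_fun v"
    define t where "t = inverse_fun \<tau>"
    have tS: "0 < t" "t \<le> S" "\<Phi> t = \<tau>" "\<Phi> S = v" "0 < S"
      using p h inverse_pos inverse_mono by (auto simp: S_def t_def)
    have "(t / S) powr m * v \<le> \<tau>"
      using shrink_powr[of "t / S" S] tS by simp
    then have "(t / S) powr m \<le> \<tau> / v" using p by (simp add: field_simps)
    then have "((t / S) powr m) powr (1 / m) \<le> (\<tau> / v) powr (1 / m)"
      using m_pos by (intro powr_mono2) auto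
    then have "t / S \<le> (\<tau> / v) powr (1 / m)"
      using m_pos tS by (simp add: powr_powr)
    then show ?thesis using tS by (simp add: S_def[symmetric] t_def[symmetric] field_simps)
  qed
qed

text \<open>For \<open>v\<close> > 1 the bound \<open>upper\<close> with factor
  \<open>v powr \<sigma>\<close> takes \<open>v powr (\<sigma> * m)\<close> out of \<Phi>. As
  \<sigma> m < 1, this power is absorbed on the left, and the implicit inequality becomes an a
  priori bound.\<close>

lemma subcritical_bound:
  assumes "0 \<le> v" "v \<le> 2 * \<Phi> (b * v powr \<sigma>)" "0 \<le> b" "0 < \<sigma>" "\<sigma> * m < 1"
  shows "v \<le> max 1 ((2 * \<Phi> b) powr (1 / (1 - \<sigma> * m)))"
proof (cases "v \<le> 1")
  case False
  then have v: "1 < v" by simp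
  have "v \<le> 2 * ((v powr \<sigma>) powr m * \<Phi> b)"
    using assms(2) upper[of "v powr \<sigma>" b] assms v
    by (simp add: mult.commute ge_one_powr_ge_zero)
  then have "v powr 1 \<le> v powr (\<sigma> * m) * (2 * \<Phi> b)"
    using v by (simp add: powr_powr mult_ac)
  then have "v powr (1 - \<sigma> * m) \<le> 2 * \<Phi> b"
    using v by (simp add: powr_diff field_simps)
  then have "(v powr (1 - \<sigma> * m)) powr (1 / (1 - \<sigma> * m)) \<le> (2 * \<Phi> b) powr (1 / (1 - \<sigma> * m))"
    using assms by (intro powr_mono2) auto
  then show ?thesis using v assms by (simp add: powr_powr)
qed auto

end

subsection \<open>The critical function\<close>

context growth_function
begin

text \<open>This is \<open>critical_inv\<close> with \<sigma> = s / N, since (N + s) / N = 1 +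
  \<sigma>.\<close>

definition critical_integral :: "real \<Rightarrow> real \<Rightarrow> real" where
  "critical_integral \<sigma> t = (LBINT \<tau>=0..ereal t. inverse_fun \<tau> / \<tau> powr (1 + \<sigma>))"

context
  fixes \<sigma> :: real
  assumes sigma: "0 < \<sigma>" "\<sigma> * m < 1"
begin

text \<open>By \<open>inverse_upper\<close> the integrand is dominated by a multiple of the power 1
  / m - 1 - \<sigma> of \<tau>, and this exponent exceeds -1 because \<sigma> m < 1.\<close>

lemma set_integrable_critical:
  assumes "0 \<le> v"
  shows "set_integrable lborel {0..v} (\<lambda>\<tau>. inverse_fun \<tau> / \<tau> powr (1 + \<sigma>))"
proof (cases "v = 0")
  case True
  then have "(\<lambda>\<tau>. indicator {0..v} \<tau> *\<^sub>R (inverse_fun \<tau> / \<tau> powr (1 + \<sigma>))) = (\<lambda>_. 0)"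
    by (auto simp: fun_eq_iff indicator_def)
  then show ?thesis by (simp only: set_integrable_def integrable_zero)
next
  case False
  then have v: "0 < v" using assms by simp
  define C where "C = inverse_fun v / v powr (1 / m)"
  define h where "h = (\<lambda>\<tau>. C * \<tau> powr (1 / m - 1 - \<sigma>))"
  have C: "0 \<le> C" using inverse_nonneg[of v] v by (simp add: C_def)
  have "1 / m - 1 - \<sigma> > -1" using sigma m_pos by (simp add: field_simps)
  then have "h integrable_on {0..v}"
    using integrable_cmul[OF integrable_on_powr_from_0, of "1 / m - 1 - \<sigma>" v C] v by (simp add: h_def)
  then have "h absolutely_integrable_on {0..v}"
    by (rule nonnegative_absolutely_integrable_1) (simp add: h_def C)
  \<comment> \<open>Absolute integrability refers to the completed measure; Borel measurability of
    \<open>h\<close> allows the return to \<open>lborel\<close>.\<close>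
  then have h: "set_integrable lborel {0..v} h"
    unfolding set_integrable_def by (subst (asm) integrable_completion) (auto simp: h_def)
  show ?thesis
  proof (rule set_integrable_bound[OF h])
    \<comment> \<open>\<open>inverse_fun\<close> is unspecified on negative arguments. Cutting the
      argument off at 0 gives a function monotone on the whole line, hence Borel.\<close>
    have "mono (\<lambda>\<tau>. inverse_fun (max 0 \<tau>))"
      by (intro monoI inverse_mono) auto
    then have [measurable]: "(\<lambda>\<tau>. inverse_fun (max 0 \<tau>)) \<in> borel_measurable borel"
      by (rule borel_measurable_mono)
    have "(\<lambda>\<tau>. indicator {0..v} \<tau> * (inverse_fun (max 0 \<tau>) / \<tau> powr (1 + \<sigma>))) \<in> borel_measurable lborel"
      by measurable
    also have "(\<lambda>\<tau>. indicator {0..v} \<tau> * (inverse_fun (max 0 \<tau>) / \<tau> powr (1 + \<sigma>)))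
      = (\<lambda>\<tau>. indicator {0..v} \<tau> *\<^sub>R (inverse_fun \<tau> / \<tau> powr (1 + \<sigma>)))"
      by (auto simp: indicator_def max_def)
    finally show "set_borel_measurable lborel {0..v} (\<lambda>\<tau>. inverse_fun \<tau> / \<tau> powr (1 + \<sigma>))"
      by (simp add: set_borel_measurable_def)
    show "AE \<tau> in lborel. \<tau> \<in> {0..v} \<longrightarrow> norm (inverse_fun \<tau> / \<tau> powr (1 + \<sigma>)) \<le> norm (h \<tau>)"
    proof (intro AE_I2 impI)
      fix \<tau> assume t: "\<tau> \<in> {0..v}"
      show "norm (inverse_fun \<tau> / \<tau> powr (1 + \<sigma>)) \<le> norm (h \<tau>)"
      proof (cases "\<tau> = 0")
        case False
        then have "inverse_fun \<tau> \<le> C * \<tau> powr (1 / m)"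
          using inverse_upper[of \<tau> v] t v by (simp add: C_def powr_divide)
        then have "inverse_fun \<tau> / \<tau> powr (1 + \<sigma>) \<le> C * \<tau> powr (1 / m) / \<tau> powr (1 + \<sigma>)"
          by (rule divide_right_mono) simp
        also have "\<dots> = h \<tau>" using t False by (simp add: h_def powr_diff powr_add)
        finally show ?thesis using inverse_nonneg[of \<tau>] t by simp
      qed simp
    qed
  qed
qed

lemma critical_integral_eq:
  "0 \<le> t \<Longrightarrow> critical_integral \<sigma> t = integral {0..t} (\<lambda>\<tau>. inverse_fun \<tau> / \<tau> powr (1 + \<sigma>))"
  unfolding critical_integral_def zero_ereal_def
  by (intro interval_integral_eq_integral set_integrable_critical)

lemma critical_integrable_on:
  "0 \<le> x \<Longrightarrow> (\<lambda>\<tau>. inverse_fun \<tau> / \<tau> powr (1 + \<sigma>)) integrable_on {x..y}"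
  using set_borel_integral_eq_integral(1)[OF set_integrable_critical, of y]
  by (cases "x \<le> y") (auto intro: integrable_on_subinterval)

lemma critical_integral_continuous: "continuous_on {0..v} (critical_integral \<sigma>)"
  using indefinite_integral_continuous_1[OF critical_integrable_on[of 0 v]]
  by (rule continuous_on_eq) (auto simp: critical_integral_eq)

text \<open>Only the right half of the interval is kept. There the inverse is at least its midpoint
  value and the denominator at most its value at \<open>y\<close>.\<close>

lemma critical_integral_step:
  assumes "0 \<le> x" "x < y"
  shows "critical_integral \<sigma> x + inverse_fun ((x + y) / 2) / y powr (1 + \<sigma>) * ((y - x) / 2) \<le> critical_integral \<sigma> y"
proof -
  let ?g = "\<lambda>\<tau>. inverse_fun \<tau> / \<tau> powr (1 + \<sigma>)" and ?z = "(x + y) / 2"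
  have split: "critical_integral \<sigma> y = integral {0..x} ?g + integral {x..?z} ?g + integral {?z..y} ?g"
    using assms critical_integrable_on[of 0] by (simp add: critical_integral_eq Henstock_Kurzweil_Integration.integral_combine)
  have "0 \<le> integral {x..?z} ?g"
    using assms critical_integrable_on[of x] inverse_nonneg
    by (intro Henstock_Kurzweil_Integration.integral_nonneg) auto
  moreover have "inverse_fun ?z / y powr (1 + \<sigma>) * (y - ?z) \<le> integral {?z..y} ?g"
  proof -
    have "integral {?z..y} (\<lambda>\<tau>. inverse_fun ?z / y powr (1 + \<sigma>)) \<le> integral {?z..y} ?g"
    proof (rule Henstock_Kurzweil_Integration.integral_le)
      show "?g integrable_on {?z..y}" using assms by (intro critical_integrable_on) auto
      fix \<tau> assume "\<tau> \<in> {?z..y}"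
      then show "inverse_fun ?z / y powr (1 + \<sigma>) \<le> ?g \<tau>"
        using assms sigma inverse_nonneg[of \<tau>]
        by (intro frac_le inverse_mono powr_mono2) auto
    qed auto
    then show ?thesis using assms by (simp add: field_simps)
  qed
  moreover have "critical_integral \<sigma> x = integral {0..x} ?g"
    using assms by (simp add: critical_integral_eq)
  moreover have "y - ?z = (y - x) / 2" by (simp add: field_simps)
  ultimately show ?thesis using split by (simp only:)
qed

lemma critical_integral_strict: "0 \<le> x \<Longrightarrow> x < y \<Longrightarrow> critical_integral \<sigma> x < critical_integral \<sigma> y"
proof -
  assume a: "0 \<le> x" "x < y"
  then have "0 < inverse_fun ((x + y) / 2) / y powr (1 + \<sigma>) * ((y - x) / 2)"
    by (intro mult_pos_pos divide_pos_pos inverse_pos) auto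
  then show ?thesis using critical_integral_step[OF a] by linarith
qed

lemma critical_integral_zero: "critical_integral \<sigma> 0 = 0"
  by (simp add: critical_integral_eq)

text \<open>The step estimate from 0 to \<open>v\<close>, solved for the inverse at
  \<open>v / 2\<close> and then mapped by \<Phi>. One factor 2 is due to the midpoint, the other to
  the half length.\<close>

lemma critical_integral_bound:
  assumes "0 \<le> v" "critical_integral \<sigma> v \<le> x"
  shows "v \<le> 2 * \<Phi> (2 * x * v powr \<sigma>)"
proof (cases "v = 0")
  case False
  then have v: "0 < v" using assms by simp
  have "inverse_fun (v / 2) / v powr (1 + \<sigma>) * (v / 2) \<le> x"
    using critical_integral_step[of 0 v] assms v critical_integral_zero by simp
  then have "inverse_fun (v / 2) \<le> 2 * x * v powr \<sigma>"
    using v by (simp add: powr_add field_simps)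
  then have "\<Phi> (inverse_fun (v / 2)) \<le> \<Phi> (2 * x * v powr \<sigma>)"
    using v by (intro increasing inverse_nonneg) auto
  then show ?thesis using v by simp
qed auto

text \<open>This makes the \<open>the_inv_into\<close> in \<open>critical_function\<close> a genuine
  inverse on the half-line.\<close>

lemma critical_integral_bij:
  "inj_on (critical_integral \<sigma>) {0..}" "0 \<le> x \<Longrightarrow> x \<in> critical_integral \<sigma> ` {0..}"
proof -
  show "inj_on (critical_integral \<sigma>) {0..}"
    by (rule linorder_inj_onI') (use critical_integral_strict in force)
  assume x: "0 \<le> x"
  \<comment> \<open>One more than the a priori bound of \<open>subcritical_bound\<close>: an
    integral still below \<open>x\<close> at this \<open>v\<close> would contradict that
    bound.\<close>
  define v where "v = max 1 ((2 * \<Phi> (2 * x)) powr (1 / (1 - \<sigma> * m))) + 1"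
  have v: "0 \<le> v" by (simp add: v_def)
  have "x \<le> critical_integral \<sigma> v"
  proof (rule ccontr)
    assume "\<not> x \<le> critical_integral \<sigma> v"
    then have "v \<le> 2 * \<Phi> (2 * x * v powr \<sigma>)"
      using v by (intro critical_integral_bound) auto
    then have "v \<le> max 1 ((2 * \<Phi> (2 * x)) powr (1 / (1 - \<sigma> * m)))"
      using v x sigma by (intro subcritical_bound) auto
    then show False by (simp add: v_def)
  qed
  then obtain z where "0 \<le> z" "z \<le> v" "critical_integral \<sigma> z = x"
    using IVT'[of "critical_integral \<sigma>" 0 x v] critical_integral_zero x v critical_integral_continuous
    by auto
  then show "x \<in> critical_integral \<sigma> ` {0..}" by auto
qed

end

lemma critical_function_bound:
  assumes "0 < N" "0 < s" "s / real N * m < 1" "0 \<le> x"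
  defines "v \<equiv> critical_function N s \<Phi> x"
  shows "0 \<le> v" "v \<le> 2 * \<Phi> (2 * x * v powr (s / real N))"
proof -
  have eq: "critical_inv N s \<Phi> = critical_integral (s / real N)"
    using assms(1) by (simp add: fun_eq_iff critical_inv_def critical_integral_def inverse_fun_def add_divide_distrib)
  have s: "0 < s / real N" using assms by simp
  note bij = critical_integral_bij[OF s assms(3)]
  have v: "v = the_inv_into {0..} (critical_integral (s / real N)) x"
    using assms(4) by (simp add: v_def critical_function_def eq)
  show "0 \<le> v"
    using the_inv_into_into[OF bij(1) bij(2)[OF assms(4)] order_refl] by (simp add: v)
  moreover have "critical_integral (s / real N) v = x"
    unfolding v by (rule f_the_inv_into_f[OF bij(1) bij(2)[OF assms(4)]])
  ultimately show "v \<le> 2 * \<Phi> (2 * x * v powr (s / real N))"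
    using critical_integral_bound[OF s assms(3)] by simp
qed

end

subsection \<open>The inner Gagliardo integral\<close>

text \<open>A countable cover by sets of finite measure keeps its measures in the completion.
  Tonelli's theorem for \<open>lebesgue\<close> rests on this.\<close>

lemma sigma_finite_completion:
  assumes "sigma_finite_measure M"
  shows "sigma_finite_measure (completion M)"
proof -
  obtain A where "countable A" "A \<subseteq> sets M" "\<Union>A = space M" "\<forall>a\<in>A. emeasure M a \<noteq> \<infinity>"
    using sigma_finite_measure.sigma_finite_countable[OF assms] by blast
  then show ?thesis
    by (intro sigma_finite_measure.intro exI[of _ A]) auto
qed

interpretation lebesgue: sigma_finite_measure lebesgue
  by (rule sigma_finite_completion) (rule lborel.sigma_finite_measure_axioms)

lemma level_set_lebesgue:
  fixes w :: "'a::euclidean_space \<Rightarrow> real"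
  assumes "w \<in> borel_measurable lebesgue"
  shows "{x. t < \<bar>w x\<bar>} \<in> sets lebesgue"
  using measurable_sets[of "\<lambda>x. \<bar>w x\<bar>" lebesgue borel "{t<..}"] assms by (simp add: vimage_def)

text \<open>Chebyshev's inequality. The function \<open>f\<close> will be either \<Phi> composed
  with \<open>w\<close> or the inner energy.\<close>

lemma emeasure_level_le:
  fixes w :: "'a::euclidean_space \<Rightarrow> real"
  assumes [measurable]: "w \<in> borel_measurable lebesgue"
    and "0 < c" and "\<And>x. t < \<bar>w x\<bar> \<Longrightarrow> ennreal c \<le> f x" and "(\<integral>\<^sup>+x. f x \<partial>lebesgue) \<le> 1"
  shows "emeasure lebesgue {x. t < \<bar>w x\<bar>} \<le> ennreal (1 / c)"
proof -
  note level_set_lebesgue[OF assms(1), measurable]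
  have "ennreal c * emeasure lebesgue {x. t < \<bar>w x\<bar>}
      = (\<integral>\<^sup>+x. ennreal c * indicator {x. t < \<bar>w x\<bar>} x \<partial>lebesgue)"
    by (simp add: nn_integral_cmult_indicator)
  also have "\<dots> \<le> (\<integral>\<^sup>+x. f x \<partial>lebesgue)"
    using assms by (intro nn_integral_mono) (auto simp: indicator_def)
  finally have "ennreal c * emeasure lebesgue {x. t < \<bar>w x\<bar>} \<le> 1"
    using assms(4) by simp
  then have "ennreal (1 / c) * (ennreal c * emeasure lebesgue {x. t < \<bar>w x\<bar>}) \<le> ennreal (1 / c) * 1"
    by (rule mult_left_mono) simp
  then show ?thesis
    using assms(2) by (simp add: mult.assoc[symmetric] ennreal_mult[symmetric])
qed

lemma fst_snd_measurable_lebesgue [measurable]: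
  "fst \<in> measurable (lebesgue \<Otimes>\<^sub>M M) (borel :: 'a::euclidean_space measure)"
  "snd \<in> measurable (M \<Otimes>\<^sub>M lebesgue) (borel :: 'a::euclidean_space measure)"
proof -
  have id: "(\<lambda>x. x) \<in> measurable lebesgue (borel :: 'a measure)"
    by (intro measurable_completion) simp
  show "fst \<in> measurable (lebesgue \<Otimes>\<^sub>M M) (borel :: 'a measure)"
    by (rule measurable_compose[OF measurable_fst id])
  show "snd \<in> measurable (M \<Otimes>\<^sub>M lebesgue) (borel :: 'a measure)"
    by (rule measurable_compose[OF measurable_snd id])
qed

lemma D_quot_measurable:
  fixes w :: "real^'n \<Rightarrow> real"
  assumes w: "w \<in> borel_measurable lebesgue"
  shows "D_quot s w \<in> borel_measurable (lebesgue \<Otimes>\<^sub>M lebesgue)"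
proof -
  have [measurable]: "(\<lambda>z. w (fst z)) \<in> borel_measurable (lebesgue \<Otimes>\<^sub>M lebesgue)"
    "(\<lambda>z. w (snd z)) \<in> borel_measurable (lebesgue \<Otimes>\<^sub>M lebesgue)"
    by (rule measurable_compose[OF measurable_fst w], rule measurable_compose[OF measurable_snd w])
  have "D_quot s w = (\<lambda>z. (w (fst z) - w (snd z)) / norm (fst z - snd z) powr s)"
    by (auto simp: D_quot_def)
  then show ?thesis by simp
qed

lemma mu_density_measurable:
  "(\<lambda>(x, y). ennreal (1 / norm (x - y :: real^'n) ^ CARD('n))) \<in> borel_measurable (lebesgue \<Otimes>\<^sub>M lebesgue)"
  by (simp add: case_prod_beta')

context growth_function
begin

text \<open>The function J of the introduction. The kernel stays a separate factor to match the
  density of \<open>mu\<close>.\<close>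

definition inner_energy :: "real \<Rightarrow> (real^'n \<Rightarrow> real) \<Rightarrow> real^'n \<Rightarrow> ennreal" where
  "inner_energy s w x =
     (\<integral>\<^sup>+y. ennreal (1 / norm (x - y) ^ CARD('n)) * ennreal (\<Phi> (D_quot s w (x, y))) \<partial>lebesgue)"

lemma energy_density_measurable:
  fixes w :: "real^'n \<Rightarrow> real"
  assumes "w \<in> borel_measurable lebesgue"
  shows "(\<lambda>z. (case z of (x, y) \<Rightarrow> ennreal (1 / norm (x - y) ^ CARD('n))) * ennreal (\<Phi> (D_quot s w z)))
    \<in> borel_measurable (lebesgue \<Otimes>\<^sub>M lebesgue)"
  using mu_density_measurable D_quot_measurable[OF assms] by measurable

lemma inner_energy_measurable:
  fixes w :: "real^'n \<Rightarrow> real"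
  assumes "w \<in> borel_measurable lebesgue"
  shows "inner_energy s w \<in> borel_measurable lebesgue"
  using lebesgue.borel_measurable_nn_integral_fst[OF energy_density_measurable[OF assms]]
  unfolding inner_energy_def[abs_def] by simp

lemma nn_integral_mu:
  fixes w :: "real^'n \<Rightarrow> real"
  assumes "w \<in> borel_measurable lebesgue"
  shows "(\<integral>\<^sup>+z. ennreal (\<Phi> (D_quot s w z)) \<partial>mu) = (\<integral>\<^sup>+x. inner_energy s w x \<partial>lebesgue)"
proof -
  have [measurable]: "D_quot s w \<in> borel_measurable (lebesgue \<Otimes>\<^sub>M lebesgue)"
    using assms by (rule D_quot_measurable)
  have "(\<integral>\<^sup>+z. ennreal (\<Phi> (D_quot s w z)) \<partial>mu) =
      (\<integral>\<^sup>+z. (case z of (x, y) \<Rightarrow> ennreal (1 / norm (x - y) ^ CARD('n))) * ennreal (\<Phi> (D_quot s w z)) \<partial>(lebesgue \<Otimes>\<^sub>M lebesgue))"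
    unfolding mu_def by (rule nn_integral_density[OF mu_density_measurable]) measurable
  also have "\<dots> = (\<integral>\<^sup>+x. inner_energy s w x \<partial>lebesgue)"
    unfolding inner_energy_def
    by (subst lebesgue.nn_integral_fst[symmetric, OF energy_density_measurable[OF assms]]) simp
  finally show ?thesis .
qed

text \<open>At least half of the ball lies outside \<open>E\<close>. There the distance to
  \<open>x\<close> is below \<rho>, so the quotient is at least
  \<open>\<tau> / \<rho> powr s\<close> and the kernel at least
  \<open>1 / \<rho> ^ CARD('n)\<close>, which cancels the power of \<rho> in the volume.\<close>

lemma inner_energy_lower:
  fixes w :: "real^'n \<Rightarrow> real"
  assumes E: "E \<in> sets lebesgue"
    and small: "emeasure lebesgue (E \<inter> ball x \<rho>) \<le> ennreal (unit_ball_vol (real CARD('n)) * \<rho> ^ CARD('n) / 2)"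
    and jump: "\<And>y. y \<notin> E \<Longrightarrow> \<tau> \<le> \<bar>w x - w y\<bar>"
    and "0 < \<tau>" "0 < \<rho>" "0 < s"
  shows "ennreal (unit_ball_vol (real CARD('n)) / 2 * \<Phi> (\<tau> / \<rho> powr s)) \<le> inner_energy s w x"
proof -
  let ?\<omega> = "unit_ball_vol (real CARD('n))"
  let ?c = "\<Phi> (\<tau> / \<rho> powr s) / \<rho> ^ CARD('n)"
  have \<omega>: "0 < ?\<omega>" by simp
  have fin: "emeasure lebesgue (E \<inter> ball x \<rho>) \<noteq> \<infinity>"
    using small by (auto simp: top_unique)
  have "ennreal (?\<omega> * \<rho> ^ CARD('n) / 2) = ennreal (?\<omega> * \<rho> ^ CARD('n)) - ennreal (?\<omega> * \<rho> ^ CARD('n) / 2)"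
    using assms \<omega> by (subst ennreal_minus) (auto simp: field_simps)
  also have "\<dots> \<le> emeasure lebesgue (ball x \<rho>) - emeasure lebesgue (E \<inter> ball x \<rho>)"
    using assms by (intro ennreal_minus_mono small) (simp add: emeasure_ball)
  also have "\<dots> = emeasure lebesgue (ball x \<rho> - E \<inter> ball x \<rho>)"
    using fin E by (subst emeasure_Diff) auto
  also have "ball x \<rho> - E \<inter> ball x \<rho> = ball x \<rho> - E" by auto
  finally have vol: "ennreal (?\<omega> * \<rho> ^ CARD('n) / 2) \<le> emeasure lebesgue (ball x \<rho> - E)" .
  have "ennreal (?\<omega> / 2 * \<Phi> (\<tau> / \<rho> powr s)) = ennreal ?c * ennreal (?\<omega> * \<rho> ^ CARD('n) / 2)"
    using assms by (subst ennreal_mult[symmetric]) (auto simp: field_simps)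
  also have "\<dots> \<le> ennreal ?c * emeasure lebesgue (ball x \<rho> - E)"
    by (rule mult_left_mono[OF vol]) simp
  also have "\<dots> = (\<integral>\<^sup>+y. ennreal ?c * indicator (ball x \<rho> - E) y \<partial>lebesgue)"
    using E by (intro nn_integral_cmult_indicator[symmetric]) auto
  also have "\<dots> \<le> inner_energy s w x"
    unfolding inner_energy_def
  proof (rule nn_integral_mono)
    fix y
    show "ennreal ?c * indicator (ball x \<rho> - E) y
        \<le> ennreal (1 / norm (x - y) ^ CARD('n)) * ennreal (\<Phi> (D_quot s w (x, y)))"
    proof (cases "y \<in> ball x \<rho> - E")
      case True
      then have j: "\<tau> \<le> \<bar>w x - w y\<bar>" and n: "norm (x - y) < \<rho>"
        using jump by (auto simp: dist_norm)
      \<comment> \<open>The positive jump excludes the diagonal, where kernel and quotient have the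
        default value 0.\<close>
      then have n0: "0 < norm (x - y)" using \<open>0 < \<tau>\<close> by auto
      have "\<tau> / \<rho> powr s \<le> \<bar>w x - w y\<bar> / norm (x - y) powr s"
        using j n n0 assms by (intro frac_le powr_mono2) auto
      then have "\<Phi> (\<tau> / \<rho> powr s) \<le> \<Phi> (\<bar>w x - w y\<bar> / norm (x - y) powr s)"
        using assms by (intro increasing) auto
      also have "\<dots> = \<Phi> (D_quot s w (x, y))"
        using abs_eq[of "D_quot s w (x, y)"] by (simp add: D_quot_def abs_divide)
      finally have "?c \<le> \<Phi> (D_quot s w (x, y)) / norm (x - y) ^ CARD('n)"
        using n n0 by (intro frac_le power_mono) auto
      then show ?thesis using True
        by (simp add: ennreal_mult[symmetric] ennreal_leI)
    qed auto
  qed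
  finally show ?thesis .
qed

text \<open>\<open>inner_energy_lower\<close> with the level set at height \<open>t\<close> as
  \<open>E\<close>; the jump is at least \<open>t\<close> because the value at \<open>x\<close>
  exceeds \<open>2 * t\<close>. As \<open>q\<close> \<ge> 1, \<open>shrink_powr\<close> then moves
  the power of \<open>q\<close> out of \<Phi>.\<close>

lemma inner_energy_level:
  fixes w :: "real^'n \<Rightarrow> real"
  assumes s: "0 < s" and w: "w \<in> borel_measurable lebesgue"
    and "0 < t" "0 < v" "1 \<le> q" "2 * t < \<bar>w x\<bar>"
    and a: "emeasure lebesgue {x. t < \<bar>w x\<bar>} \<le> ennreal (unit_ball_vol (real CARD('n)) / 2 * q / v)"
  shows "ennreal (unit_ball_vol (real CARD('n)) / 2 * q powr (- (s / real CARD('n) * m)) * \<Phi> (t * v powr (s / real CARD('n))))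
    \<le> inner_energy s w x"
proof -
  let ?N = "real CARD('n)" and ?\<omega> = "unit_ball_vol (real CARD('n))"
  let ?\<sigma> = "s / real CARD('n)"
  \<comment> \<open>This radius makes the assumed measure bound exactly half the volume of the
    ball.\<close>
  define \<rho> where "\<rho> = (q / v) powr (1 / ?N)"
  have \<rho>: "0 < \<rho>" using assms by (simp add: \<rho>_def)
  have \<rho>N: "\<rho> ^ CARD('n) = q / v"
    using assms by (simp add: \<rho>_def powr_realpow[symmetric] powr_powr)
  have "ennreal (?\<omega> / 2 * \<Phi> (t / \<rho> powr s)) \<le> inner_energy s w x"
  proof (rule inner_energy_lower)
    show "emeasure lebesgue ({x. t < \<bar>w x\<bar>} \<inter> ball x \<rho>) \<le> ennreal (?\<omega> * \<rho> ^ CARD('n) / 2)"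
      using order_trans[OF emeasure_mono a, of "{x. t < \<bar>w x\<bar>} \<inter> ball x \<rho>"]
      by (simp add: \<rho>N mult.commute level_set_lebesgue[OF w])
    show "t \<le> \<bar>w x - w y\<bar>" if "y \<notin> {x. t < \<bar>w x\<bar>}" for y
      using that assms by auto
  qed (use assms \<rho> level_set_lebesgue[OF w] in auto)
  moreover have "t / \<rho> powr s = q powr (- ?\<sigma>) * (t * v powr ?\<sigma>)"
    using assms by (simp add: \<rho>_def powr_powr powr_divide powr_minus field_simps)
  moreover have "q powr (- (?\<sigma> * m)) * \<Phi> (t * v powr ?\<sigma>) \<le> \<Phi> (q powr (- ?\<sigma>) * (t * v powr ?\<sigma>))"
  proof -
    have "q powr (- ?\<sigma>) \<le> q powr 0" using assms s by (intro powr_mono) auto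
    then show ?thesis
      using shrink_powr[of "q powr (- ?\<sigma>)" "t * v powr ?\<sigma>"] assms by (simp add: powr_powr)
  qed
  ultimately show ?thesis
    by (elim order_trans[rotated]) (auto intro!: ennreal_leI mult_left_mono simp: mult.assoc)
qed

end

subsection \<open>Level set estimates\<close>

text \<open>The least \<open>n\<close> with \<open>t \<le> 2 ^ n\<close> is at least 2, and
  \<open>k\<close> is \<open>n - 2\<close>. The lower bound provides the jump required by
  \<open>inner_energy_level\<close>.\<close>

lemma dyadic_level:
  fixes t :: real
  assumes "2 < t"
  obtains k :: nat where "2 * 2 ^ k < t" "t \<le> 4 * 2 ^ k"
proof -
  obtain j :: nat where "t \<le> 2 ^ j"
    using real_arch_pow[of 2 t] less_imp_le by auto
  define n where "n = (LEAST n. t \<le> 2 ^ n)"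
  have n: "t \<le> 2 ^ n" unfolding n_def using \<open>t \<le> 2 ^ j\<close> by (rule LeastI)
  have "\<not> n < 2"
  proof
    assume "n < 2"
    then have "(2::real) ^ n \<le> 2 ^ 1" by (intro power_increasing) auto
    then show False using n assms by simp
  qed
  then obtain k where k: "n = Suc (Suc k)"
    by (metis add_2_eq_Suc le_iff_add not_less)
  have "\<not> t \<le> 2 ^ Suc k"
    unfolding n_def[symmetric] using not_less_Least[of "Suc k" "\<lambda>n. t \<le> 2 ^ n"] k by (simp add: n_def)
  then show ?thesis using that[of k] n k by simp
qed

context growth_function
begin

text \<open>The normalised class over which the constants below are uniform. It is stated by
  modulars because Chebyshev's inequality uses these directly.\<close>

definition unit_modular :: "real \<Rightarrow> (real^'n \<Rightarrow> real) \<Rightarrow> bool" where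
  "unit_modular s w \<longleftrightarrow> w \<in> borel_measurable lebesgue \<and>
     (\<integral>\<^sup>+x. ennreal (\<Phi> (w x)) \<partial>lebesgue) \<le> 1 \<and> (\<integral>\<^sup>+x. inner_energy s w x \<partial>lebesgue) \<le> 1"

lemma unit_modular_level:
  assumes "unit_modular s w" "0 < t"
  shows "emeasure lebesgue {x. t < \<bar>w x\<bar>} \<le> ennreal (1 / \<Phi> t)"
proof (rule emeasure_level_le[where f = "\<lambda>x. ennreal (\<Phi> (w x))"])
  fix x assume "t < \<bar>w x\<bar>"
  then show "ennreal (\<Phi> t) \<le> ennreal (\<Phi> (w x))"
    using increasing[of t "\<bar>w x\<bar>"] assms by (intro ennreal_leI) simp
qed (use assms pos in \<open>auto simp: unit_modular_def\<close>)

text \<open>The divisor \<Lambda> = \<open>2 powr (m / (1 - \<sigma> * m))\<close> solves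
  \<open>(2 * \<Lambda> powr \<sigma>) powr m = \<Lambda>\<close>. Hence halving the level and
  dividing \<open>v\<close> by \<Lambda> costs a factor \<Lambda> on both sides of the
  inequality.\<close>

lemma doubling_subcritical:
  assumes "0 < v" "v \<le> 2 * \<Phi> (2 * t * v powr \<sigma>)" "0 \<le> t" "0 < \<sigma>" "\<sigma> * m < 1"
  defines "v' \<equiv> v / 2 powr (m / (1 - \<sigma> * m))"
  shows "v' \<le> 2 * \<Phi> (t * v' powr \<sigma>)"
proof -
  define \<Lambda> where "\<Lambda> = (2::real) powr (m / (1 - \<sigma> * m))"
  have \<Lambda>: "1 \<le> \<Lambda>" using assms m_pos by (simp add: \<Lambda>_def ge_one_powr_ge_zero)
  have v: "v = \<Lambda> * v'" "0 < v'" using \<Lambda> assms by (auto simp: v'_def \<Lambda>_def)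
  have "\<Lambda> powr (1 - \<sigma> * m) = 2 powr m"
    using assms by (simp add: \<Lambda>_def powr_powr)
  then have \<Lambda>m: "(2 * \<Lambda> powr \<sigma>) powr m = \<Lambda>"
    using \<Lambda> by (simp add: powr_mult powr_powr powr_diff field_simps)
  have "1 \<le> 2 * \<Lambda> powr \<sigma>" using \<Lambda> assms(4) ge_one_powr_ge_zero[of \<Lambda> \<sigma>] by simp
  then have "\<Phi> ((2 * \<Lambda> powr \<sigma>) * (t * v' powr \<sigma>)) \<le> \<Lambda> * \<Phi> (t * v' powr \<sigma>)"
    using upper[of "2 * \<Lambda> powr \<sigma>" "t * v' powr \<sigma>"] assms(3) \<Lambda>m by simp
  moreover have "2 * t * v powr \<sigma> = (2 * \<Lambda> powr \<sigma>) * (t * v' powr \<sigma>)"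
    using v \<Lambda> by (simp add: powr_mult)
  ultimately have "\<Phi> (2 * t * v powr \<sigma>) \<le> \<Lambda> * \<Phi> (t * v' powr \<sigma>)"
    by (simp only:)
  then have "\<Lambda> * v' \<le> \<Lambda> * (2 * \<Phi> (t * v' powr \<sigma>))"
    unfolding v(1)[symmetric] using assms(2) by linarith
  then show ?thesis using \<Lambda> by simp
qed

text \<open>The constant \<open>q\<close> survives the induction step because that step multiplies \<open>q powr (\<sigma> * m)\<close> by a
  fixed factor and \<open>\<sigma> * m < 1\<close>.\<close>

lemma weak_type:
  assumes s: "0 < s" "s / real CARD('n) * m < 1"
  obtains q where "1 \<le> q"
    and "\<And>(w :: real^'n \<Rightarrow> real) k v. unit_modular s w \<Longrightarrow> 0 < v \<Longrightarrow>
           v \<le> 2 * \<Phi> (2 ^ k * v powr (s / real CARD('n))) \<Longrightarrow>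
           emeasure lebesgue {x. 2 ^ k < \<bar>w x\<bar>} \<le> ennreal (unit_ball_vol (real CARD('n)) / 2 * q / v)"
proof -
  let ?\<omega> = "unit_ball_vol (real CARD('n))" and ?\<sigma> = "s / real CARD('n)"
  have \<omega>: "0 < ?\<omega>" by simp
  have \<sigma>: "0 < ?\<sigma>" using s by simp
  define \<Lambda> where "\<Lambda> = (2::real) powr (m / (1 - ?\<sigma> * m))"
  have \<Lambda>: "0 < \<Lambda>" by (simp add: \<Lambda>_def)
  \<comment> \<open>By \<open>subcritical_bound\<close>, every \<open>v\<close> admissible at level
    \<open>2 ^ 0\<close> is at most \<open>B\<close>.\<close>
  define B where "B = max 1 ((2 * \<Phi> 1) powr (1 / (1 - ?\<sigma> * m)))"
  \<comment> \<open>The entry with \<open>B\<close> settles level 1 by Chebyshev's inequality for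
    \<Phi>; the last entry closes the induction step.\<close>
  define q where "q = max 1 (max (2 * B / (?\<omega> * \<Phi> 1)) ((8 * \<Lambda> / ?\<omega>\<^sup>2) powr (1 / (1 - ?\<sigma> * m))))"
  have q1: "1 \<le> q" by (simp add: q_def)
  have \<Phi>1: "0 < \<Phi> 1" by (simp add: pos)
  have qB: "B / \<Phi> 1 \<le> ?\<omega> / 2 * q"
  proof -
    have "2 * B / (?\<omega> * \<Phi> 1) \<le> q" by (simp add: q_def)
    then show ?thesis using \<omega> \<Phi>1 by (simp add: field_simps)
  qed
  have q\<Lambda>: "8 * \<Lambda> / ?\<omega>\<^sup>2 * q powr (?\<sigma> * m) \<le> q"
  proof -
    have "((8 * \<Lambda> / ?\<omega>\<^sup>2) powr (1 / (1 - ?\<sigma> * m))) powr (1 - ?\<sigma> * m) \<le> q powr (1 - ?\<sigma> * m)"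
      using s by (intro powr_mono2) (auto simp: q_def)
    then have "8 * \<Lambda> / ?\<omega>\<^sup>2 \<le> q powr (1 - ?\<sigma> * m)"
      using s \<Lambda> \<omega> by (simp add: powr_powr)
    then have "8 * \<Lambda> / ?\<omega>\<^sup>2 * q powr (?\<sigma> * m) \<le> q powr (1 - ?\<sigma> * m) * q powr (?\<sigma> * m)"
      by (rule mult_right_mono) simp
    also have "\<dots> = q" using q1 by (simp add: powr_add[symmetric])
    finally show ?thesis .
  qed
  have "emeasure lebesgue {x. 2 ^ k < \<bar>w x\<bar>} \<le> ennreal (?\<omega> / 2 * q / v)"
    if w: "unit_modular s w" and "0 < v" "v \<le> 2 * \<Phi> (2 ^ k * v powr ?\<sigma>)" for w :: "real^'n \<Rightarrow> real" and k v
    using that(2-)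
  proof (induction k arbitrary: v)
    case 0
    have "v \<le> B" unfolding B_def
      using 0 \<sigma> s by (intro subcritical_bound) auto
    then have "1 / \<Phi> 1 \<le> B / v / \<Phi> 1"
      using 0 \<Phi>1 by (simp add: field_simps)
    also have "\<dots> = B / \<Phi> 1 / v" by simp
    also have "\<dots> \<le> ?\<omega> / 2 * q / v"
      using qB 0 by (intro divide_right_mono) auto
    finally show ?case
      using unit_modular_level[OF w, of 1] by (auto intro: order_trans ennreal_leI)
  next
    case (Suc k)
    define v' where "v' = v / \<Lambda>"
    have v': "0 < v'" "v' \<le> 2 * \<Phi> (2 ^ k * v' powr ?\<sigma>)"
      using doubling_subcritical[of v "2 ^ k" ?\<sigma>] Suc.prems \<sigma> s \<Lambda>
      by (auto simp: v'_def \<Lambda>_def)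
    \<comment> \<open>By the choice of \<open>v'\<close>, \<Phi> is at least \<open>v' / 2\<close>
      in the energy estimate, so \<open>?c\<close> bounds the inner energy from below on the next
      level set; Chebyshev's inequality follows.\<close>
    let ?c = "?\<omega> / 2 * q powr (- (?\<sigma> * m)) * (v' / 2)"
    have "emeasure lebesgue {x. 2 ^ Suc k < \<bar>w x\<bar>} \<le> ennreal (1 / ?c)"
    proof (rule emeasure_level_le)
      fix x assume x: "2 ^ Suc k < \<bar>w x\<bar>"
      have "?c \<le> ?\<omega> / 2 * q powr (- (?\<sigma> * m)) * \<Phi> (2 ^ k * v' powr ?\<sigma>)"
        using v' by (intro mult_left_mono) auto
      also have "ennreal \<dots> \<le> inner_energy s w x"
        using w x q1 v' by (intro inner_energy_level s(1) Suc.IH) (auto simp: unit_modular_def)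
      finally show "ennreal ?c \<le> inner_energy s w x" by (simp add: ennreal_leI)
    qed (use w q1 v' in \<open>auto simp: unit_modular_def\<close>)
    also have "1 / ?c = ?\<omega> / 2 * (8 * \<Lambda> / ?\<omega>\<^sup>2 * q powr (?\<sigma> * m)) / v"
      using \<omega> \<Lambda> Suc.prems by (simp add: v'_def powr_minus field_simps power2_eq_square)
    also have "\<dots> \<le> ?\<omega> / 2 * q / v"
      using q\<Lambda> Suc.prems by (intro divide_right_mono mult_left_mono) auto
    finally show ?case by (simp add: ennreal_leI)
  qed
  then show ?thesis using that q1 by blast
qed

text \<open>A dyadic level just below the value at \<open>x\<close> is inserted into
  \<open>weak_type\<close>, and the result into \<open>inner_energy_level\<close>. As
  \<open>8 * a\<close> is at most 1, \<open>shrink\<close> takes it out of \<Phi>; this factor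
  \<open>a\<close> later makes the contribution of large values small.\<close>

lemma strong_type:
  assumes s: "0 < s" "s / real CARD('n) * m < 1"
  obtains C where "0 < C"
    and "\<And>(w :: real^'n \<Rightarrow> real) x v a. unit_modular s w \<Longrightarrow> 2 < \<bar>w x\<bar> \<Longrightarrow> 0 \<le> v \<Longrightarrow> 0 < a \<Longrightarrow> a \<le> 1 / 8 \<Longrightarrow>
           v \<le> 2 * \<Phi> (2 * (a * \<bar>w x\<bar>) * v powr (s / real CARD('n))) \<Longrightarrow>
           ennreal v \<le> ennreal (a * C) * inner_energy s w x"
proof -
  let ?\<omega> = "unit_ball_vol (real CARD('n))" and ?\<sigma> = "s / real CARD('n)"
  have \<omega>: "0 < ?\<omega>" by simp
  obtain q where q1: "1 \<le> q"
    and wt: "\<And>(w :: real^'n \<Rightarrow> real) k v. unit_modular s w \<Longrightarrow> 0 < v \<Longrightarrow>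
           v \<le> 2 * \<Phi> (2 ^ k * v powr ?\<sigma>) \<Longrightarrow>
           emeasure lebesgue {x. 2 ^ k < \<bar>w x\<bar>} \<le> ennreal (?\<omega> / 2 * q / v)"
    using weak_type[OF s] by blast
  define c where "c = ?\<omega> / 2 * q powr (- (?\<sigma> * m))"
  have c: "0 < c" using q1 by (simp add: c_def)
  have "ennreal v \<le> ennreal (a * (16 / c)) * inner_energy s w x"
    if w: "unit_modular s w" and x: "2 < \<bar>w x\<bar>" and v: "0 \<le> v" and a: "0 < a" "a \<le> 1 / 8"
      and b: "v \<le> 2 * \<Phi> (2 * (a * \<bar>w x\<bar>) * v powr ?\<sigma>)" for w :: "real^'n \<Rightarrow> real" and x v a
  proof (cases "v = 0")
    case False
    then have v: "0 < v" using v by simp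
    obtain k where k: "2 * 2 ^ k < \<bar>w x\<bar>" "\<bar>w x\<bar> \<le> 4 * 2 ^ k"
      using dyadic_level[OF x] by blast
    have "\<Phi> (2 * (a * \<bar>w x\<bar>) * v powr ?\<sigma>) \<le> \<Phi> ((8 * a) * (2 ^ k * v powr ?\<sigma>))"
    proof (rule increasing)
      have "2 * (a * \<bar>w x\<bar>) * v powr ?\<sigma> \<le> 2 * (a * (4 * 2 ^ k)) * v powr ?\<sigma>"
        using k a by (intro mult_right_mono mult_left_mono) auto
      then show "2 * (a * \<bar>w x\<bar>) * v powr ?\<sigma> \<le> (8 * a) * (2 ^ k * v powr ?\<sigma>)" by simp
    qed (use a in auto)
    also have "\<dots> \<le> 8 * a * \<Phi> (2 ^ k * v powr ?\<sigma>)"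
      using a by (intro shrink) auto
    finally have va: "v \<le> 16 * a * \<Phi> (2 ^ k * v powr ?\<sigma>)" using b by simp
    \<comment> \<open>Giving up the factor \<open>a\<close> yields the hypothesis of
      \<open>weak_type\<close>; the sharper \<open>va\<close> is kept for the conclusion.\<close>
    also have "\<dots> \<le> 2 * \<Phi> (2 ^ k * v powr ?\<sigma>)"
      using a by (intro mult_right_mono) auto
    finally have "emeasure lebesgue {x. 2 ^ k < \<bar>w x\<bar>} \<le> ennreal (?\<omega> / 2 * q / v)"
      using wt w v by blast
    then have J: "ennreal (c * \<Phi> (2 ^ k * v powr ?\<sigma>)) \<le> inner_energy s w x"
      unfolding c_def using w k v q1 by (intro inner_energy_level s(1)) (auto simp: unit_modular_def)
    have "ennreal v \<le> ennreal (a * (16 / c) * (c * \<Phi> (2 ^ k * v powr ?\<sigma>)))"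
      using va c by (intro ennreal_leI) (simp add: mult.commute)
    also have "\<dots> = ennreal (a * (16 / c)) * ennreal (c * \<Phi> (2 ^ k * v powr ?\<sigma>))"
      using a c by (intro ennreal_mult) auto
    also have "\<dots> \<le> ennreal (a * (16 / c)) * inner_energy s w x"
      using J by (rule mult_left_mono) simp
    finally show ?thesis .
  qed auto
  then show ?thesis using that[of "16 / c"] c by auto
qed

end

subsection \<open>The lemma of Lions type\<close>

text \<open>Since t \<Phi>'(t) / \<Phi>(t) lies between l > 1 and m, the function \<Phi>(t) / t
  increases and \<open>Phi \<phi> t * t powr (- m)\<close> decreases on the positive half-line.
  These monotonicities are \<open>lower\<close> and \<open>upper\<close>.\<close>

lemma growth_function_Phi:
  assumes "\<phi> C1_differentiable_on UNIV"
    and even: "\<And>t. Phi \<phi> (- t) = Phi \<phi> t"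
    and "phi_1 \<phi>" and "phi_2 \<phi>" and "phi_3 N \<phi>"
  obtains m where "growth_function (Phi \<phi>) m" "m < real N"
proof -
  define h where "h = (\<lambda>t. t * \<phi> t)"
  have cont: "continuous_on A h" for A
    unfolding h_def
    using continuous_on_subset[OF C1_differentiable_imp_continuous_on[OF assms(1)], of A]
    by (intro continuous_intros) auto
  have deriv: "(Phi \<phi> has_real_derivative h t) (at t)" for t
  proof -
    \<comment> \<open>The symmetric interval contains 0 and has \<open>t\<close> in its interior for
      either sign of \<open>t\<close>, so the derivative is two-sided.\<close>
    have "((\<lambda>x. LBINT y=ereal 0..ereal x. h y) has_vector_derivative h t) (at t within {- (\<bar>t\<bar> + 1)..\<bar>t\<bar> + 1})"
      by (rule interval_integral_FTC2) (auto simp: cont)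
    moreover have "at t within {- (\<bar>t\<bar> + 1)..\<bar>t\<bar> + 1} = at t"
      by (rule at_within_Icc_at) auto
    ultimately show ?thesis
      by (simp add: has_real_derivative_iff_has_vector_derivative Phi_def[abs_def] h_def zero_ereal_def)
  qed
  have Phi0: "Phi \<phi> 0 = 0"
    by (simp add: Phi_def zero_ereal_def[symmetric])
  have contP: "continuous_on A (Phi \<phi>)" for A
    using deriv by (intro DERIV_continuous_on) (auto intro: has_field_derivative_at_within)
  have smono: "h x < h y" if "0 < x" "x < y" for x y
    using \<open>phi_2 \<phi>\<close> that by (auto simp: phi_2_def h_def strict_mono_on_def)
  \<comment> \<open>A nonpositive value at \<open>t\<close> would make \<open>h (t / 2)\<close>
    negative and an upper bound for \<open>h\<close> nearer to 0, against the limit 0.\<close>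
  have h_pos: "0 < h t" if t: "0 < t" for t
  proof (rule ccontr)
    assume "\<not> 0 < h t"
    then have "h (t / 2) < 0" using smono[of "t / 2" t] t by simp
    moreover have "(h \<longlongrightarrow> 0) (at_right 0)"
      using \<open>phi_1 \<phi>\<close> unfolding phi_1_def h_def by (auto intro: tendsto_within_subset[of _ _ 0 UNIV])
    ultimately have "\<forall>\<^sub>F x in at_right 0. h (t / 2) < h x"
      by (intro order_tendstoD(1)) auto
    moreover have "\<forall>\<^sub>F x in at_right 0. x \<in> {0<..<t / 2}"
      using t by (intro eventually_at_right_real) auto
    ultimately have "\<forall>\<^sub>F x in at_right (0::real). False"
      by eventually_elim (use smono[of _ "t / 2"] in force)
    then show False by (simp add: trivial_limit_at_right_real)
  qed
  have Phi_pos: "0 < Phi \<phi> t" if "0 < t" for t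
  proof -
    have "Phi \<phi> 0 < Phi \<phi> t"
    proof (rule DERIV_pos_imp_increasing_open[OF that])
      show "\<exists>y. (Phi \<phi> has_real_derivative y) (at x) \<and> 0 < y" if "0 < x" for x
        using deriv h_pos[OF that] by (intro exI conjI)
    qed (rule contP)
    then show ?thesis by (simp add: Phi0)
  qed
  obtain l m where l: "1 < l" and m: "1 < m" "m < real N"
    and lm: "\<And>t. 0 < t \<Longrightarrow> l \<le> t\<^sup>2 * \<phi> t / Phi \<phi> t \<and> t\<^sup>2 * \<phi> t / Phi \<phi> t \<le> m"
    using \<open>phi_3 N \<phi>\<close> by (auto simp: phi_3_def)
  have h_le: "t * h t \<le> m * Phi \<phi> t" and h_ge: "Phi \<phi> t \<le> t * h t" if "0 < t" for t
  proof -
    have "t\<^sup>2 * \<phi> t = t * h t" by (simp add: h_def power2_eq_square)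
    then have "l * Phi \<phi> t \<le> t * h t" "t * h t \<le> m * Phi \<phi> t"
      using lm[OF that] Phi_pos[OF that] by (auto simp: field_simps)
    moreover have "1 * Phi \<phi> t \<le> l * Phi \<phi> t"
      using l Phi_pos[OF that] by (intro mult_right_mono) auto
    ultimately show "t * h t \<le> m * Phi \<phi> t" "Phi \<phi> t \<le> t * h t" by auto
  qed
  have up: "Phi \<phi> (c * t) \<le> c powr m * Phi \<phi> t" if "1 \<le> c" "0 \<le> t" for c t
  proof (cases "t = 0")
    case False
    then have t: "0 < t" "t \<le> c * t" using that by auto
    have "Phi \<phi> (c * t) * (c * t) powr (- m) \<le> Phi \<phi> t * t powr (- m)"
    proof (rule DERIV_nonpos_imp_nonincreasing[OF t(2)])
      fix x assume "t \<le> x" "x \<le> c * t"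
      then have x: "0 < x" using t by simp
      have "((\<lambda>x. Phi \<phi> x * x powr (- m)) has_real_derivative
          (h x * x powr (- m) + (- m * x powr (- m - 1)) * Phi \<phi> x)) (at x)"
        using x by (intro DERIV_mult deriv has_real_derivative_powr)
      moreover have "h x * x powr (- m) + (- m * x powr (- m - 1)) * Phi \<phi> x
          = (x * h x - m * Phi \<phi> x) * x powr (- m - 1)"
        using x by (simp add: powr_diff field_simps)
      moreover have "\<dots> \<le> 0"
        using h_le[OF x] by (intro mult_nonpos_nonneg) auto
      ultimately show "\<exists>y. ((\<lambda>x. Phi \<phi> x * x powr (- m)) has_real_derivative y) (at x) \<and> y \<le> 0"
        by metis
    qed
    then show ?thesis using t that
      by (simp add: powr_mult powr_minus field_simps)
  qed (simp add: Phi0)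
  have low: "c * Phi \<phi> t \<le> Phi \<phi> (c * t)" if "1 \<le> c" "0 \<le> t" for c t
  proof (cases "t = 0")
    case False
    then have t: "0 < t" "t \<le> c * t" using that by auto
    have "Phi \<phi> t / t \<le> Phi \<phi> (c * t) / (c * t)"
    proof (rule DERIV_nonneg_imp_nondecreasing[OF t(2)])
      fix x assume "t \<le> x" "x \<le> c * t"
      then have x: "0 < x" using t by simp
      have "((\<lambda>x. Phi \<phi> x / x) has_real_derivative (h x * x - Phi \<phi> x * 1) / (x * x)) (at x)"
        using x by (intro DERIV_divide deriv DERIV_ident) auto
      moreover have "0 \<le> (h x * x - Phi \<phi> x * 1) / (x * x)"
        using h_ge[OF x] by (simp add: mult.commute)
      ultimately show "\<exists>y. ((\<lambda>x. Phi \<phi> x / x) has_real_derivative y) (at x) \<and> 0 \<le> y"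
        by blast
    qed
    then show ?thesis using t that by (simp add: field_simps)
  qed (simp add: Phi0)
  have "growth_function (Phi \<phi>) m"
    by unfold_locales (use Phi0 even Phi_pos contP up low m in auto)
  then show ?thesis using that m by blast
qed

section \<open>From Luxemburg norms to modulars\<close>

lemma Inf_pos_nonneg: "S \<noteq> {} \<Longrightarrow> (\<And>k. k \<in> S \<Longrightarrow> 0 < k) \<Longrightarrow> 0 \<le> Inf S" for S :: "real set"
  by (intro cInf_greatest) (auto intro: less_imp_le)

context growth_function
begin

text \<open>Scaling by k = max 1 I, with I the finite modular, divides the modular by at least k.
  Thus the real infimum is never taken over the empty set.\<close>

lemma luxemburg_nonempty:
  assumes [measurable]: "f \<in> borel_measurable M"
    and fin: "(\<integral>\<^sup>+x. ennreal (\<Phi> \<bar>f x\<bar>) \<partial>M) < \<infinity>"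
  shows "{k. 0 < k \<and> (\<integral>\<^sup>+x. ennreal (\<Phi> (\<bar>f x\<bar> / k)) \<partial>M) \<le> 1} \<noteq> {}"
proof -
  obtain I where I: "0 \<le> I" "(\<integral>\<^sup>+x. ennreal (\<Phi> \<bar>f x\<bar>) \<partial>M) = ennreal I"
    using fin by (cases "\<integral>\<^sup>+x. ennreal (\<Phi> \<bar>f x\<bar>) \<partial>M") auto
  define k where "k = max 1 I"
  have k: "1 \<le> k" "I \<le> k" by (auto simp: k_def)
  have "(\<integral>\<^sup>+x. ennreal (\<Phi> (\<bar>f x\<bar> / k)) \<partial>M) \<le> (\<integral>\<^sup>+x. ennreal (1 / k) * ennreal (\<Phi> \<bar>f x\<bar>) \<partial>M)"
  proof (rule nn_integral_mono)
    fix x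
    have "\<Phi> (1 / k * \<bar>f x\<bar>) \<le> 1 / k * \<Phi> \<bar>f x\<bar>"
      using k by (intro shrink) auto
    then have "ennreal (\<Phi> (1 / k * \<bar>f x\<bar>)) \<le> ennreal (1 / k * \<Phi> \<bar>f x\<bar>)" by (rule ennreal_leI)
    then show "ennreal (\<Phi> (\<bar>f x\<bar> / k)) \<le> ennreal (1 / k) * ennreal (\<Phi> \<bar>f x\<bar>)"
      using k by (simp add: ennreal_mult[symmetric])
  qed
  also have "\<dots> = ennreal (1 / k) * ennreal I"
    using I(2) by (subst nn_integral_cmult) auto
  also have "\<dots> = ennreal (I / k)"
    using I k by (simp add: ennreal_mult[symmetric])
  also have "\<dots> \<le> 1" using I k by (simp add: ennreal_le_1)
  finally show ?thesis using k by force
qed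

text \<open>A number strictly above the infimum exceeds some admissible \<open>k\<close>, and the
  modular decreases in the scale.\<close>

lemma luxemburg_modular:
  assumes "S = {k. 0 < k \<and> (\<integral>\<^sup>+x. ennreal (\<Phi> (\<bar>f x\<bar> / k)) \<partial>M) \<le> 1}" "S \<noteq> {}" "Inf S < K"
  shows "(\<integral>\<^sup>+x. ennreal (\<Phi> (f x / K)) \<partial>M) \<le> 1"
proof -
  obtain k where k: "k \<in> S" "k < K" using cInf_lessD[OF assms(2,3)] by blast
  then have k0: "0 < k" by (simp add: assms(1))
  have "(\<integral>\<^sup>+x. ennreal (\<Phi> (f x / K)) \<partial>M) \<le> (\<integral>\<^sup>+x. ennreal (\<Phi> (\<bar>f x\<bar> / k)) \<partial>M)"
  proof (intro nn_integral_mono ennreal_leI)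
    fix x
    have "\<Phi> \<bar>f x / K\<bar> \<le> \<Phi> (\<bar>f x\<bar> / k)"
      using k k0 by (intro increasing) (auto simp: abs_divide intro!: frac_le)
    then show "\<Phi> (f x / K) \<le> \<Phi> (\<bar>f x\<bar> / k)" by (simp only: abs_eq)
  qed
  also have "\<dots> \<le> 1" using k(1) by (simp add: assms(1))
  finally show ?thesis .
qed

text \<open>The radius is fixed first, so small that the energy is at least \<open>1 / e\<close>
  wherever the estimate applies. Only then is \<open>n\<close> taken large, so that it applies at
  every point of the level set.\<close>

lemma vanishing_level:
  fixes w :: "nat \<Rightarrow> real^'n \<Rightarrow> real"
  assumes w: "\<And>n. unit_modular s (w n)" and "0 < s" "0 < K" "0 < r" "0 < \<delta>"
    and van: "(\<lambda>n. SUP y. \<integral>\<^sup>+x\<in>ball y r. ennreal (\<Phi> (K * w n x)) \<partial>lebesgue) \<longlonglongrightarrow> 0"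
  shows "(\<lambda>n. emeasure lebesgue {x. \<delta> < \<bar>w n x\<bar>}) \<longlonglongrightarrow> 0"
proof (rule order_tendstoI)
  fix c :: ennreal assume "0 < c"
  \<comment> \<open>As \<open>c\<close> may be infinite, a smaller finite target is used.\<close>
  then obtain c' where c': "0 < c'" "c' < c" using dense by blast
  then obtain e where e: "c' = ennreal e" "0 < e"
    by (cases c') (auto simp: top_unique)
  let ?\<omega> = "unit_ball_vol (real CARD('n))"
  have \<omega>: "0 < ?\<omega>" by simp
  define X where "X = max 1 (2 / (?\<omega> * e * \<Phi> 1))"
  have X: "1 \<le> X" by (simp add: X_def)
  have "2 / (?\<omega> * e * \<Phi> 1) \<le> X" by (simp add: X_def)
  then have "2 / (?\<omega> * e) \<le> X * \<Phi> 1"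
    using \<omega> e pos[of 1] by (simp add: field_simps)
  then have X2: "2 / (?\<omega> * e) \<le> \<Phi> X" using unbounded[OF X] by linarith
  \<comment> \<open>The bound by \<open>r\<close> brings each ball under the vanishing hypothesis;
    the other bound gives \<open>\<delta> / 2 / \<rho> powr s\<close> \<ge>
    \<open>X\<close>.\<close>
  define \<rho> where "\<rho> = min r ((\<delta> / 2 / X) powr (1 / s))"
  have \<rho>: "0 < \<rho>" "\<rho> \<le> r" using assms X by (auto simp: \<rho>_def)
  have "\<rho> powr s \<le> ((\<delta> / 2 / X) powr (1 / s)) powr s"
    using \<rho> assms by (intro powr_mono2) (auto simp: \<rho>_def)
  also have "\<dots> = \<delta> / 2 / X" using assms X by (simp add: powr_powr)
  finally have "X \<le> \<delta> / 2 / \<rho> powr s" using X \<rho> assms by (simp add: field_simps)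
  then have "2 / (?\<omega> * e) \<le> \<Phi> (\<delta> / 2 / \<rho> powr s)"
    using increasing[of X] X X2 by fastforce
  then have big: "1 / e \<le> ?\<omega> / 2 * \<Phi> (\<delta> / 2 / \<rho> powr s)"
    using \<omega> e by (simp add: field_simps)
  define b where "b = ?\<omega> * \<rho> ^ CARD('n) / 2"
  have b: "0 < b" using \<omega> \<rho> by (simp add: b_def)
  have p: "0 < \<Phi> (K * (\<delta> / 2))" using assms by (intro pos) auto
  \<comment> \<open>With \<open>b\<close> half the volume of a ball, this threshold gives the
    half-ball condition by Chebyshev's inequality, for all centres at once.\<close>
  have "\<forall>\<^sub>F n in sequentially. (SUP y. \<integral>\<^sup>+x\<in>ball y r. ennreal (\<Phi> (K * w n x)) \<partial>lebesgue)
      < ennreal (\<Phi> (K * (\<delta> / 2)) * b)"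
    using b p by (intro order_tendstoD(2)[OF van]) simp
  then show "\<forall>\<^sub>F n in sequentially. emeasure lebesgue {x. \<delta> < \<bar>w n x\<bar>} < c"
  proof eventually_elim
    case (elim n)
    have wm [measurable]: "w n \<in> borel_measurable lebesgue"
      using w by (simp add: unit_modular_def)
    define E where "E = {x. \<delta> / 2 < \<bar>w n x\<bar>}"
    have E [measurable]: "E \<in> sets lebesgue"
      unfolding E_def by (rule level_set_lebesgue[OF wm])
    have small: "emeasure lebesgue (E \<inter> ball x \<rho>) \<le> ennreal b" for x
    proof -
      have "ennreal (\<Phi> (K * (\<delta> / 2))) * emeasure lebesgue (E \<inter> ball x \<rho>)
          = (\<integral>\<^sup>+z. ennreal (\<Phi> (K * (\<delta> / 2))) * indicator (E \<inter> ball x \<rho>) z \<partial>lebesgue)"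
        by (intro nn_integral_cmult_indicator[symmetric]) auto
      also have "\<dots> \<le> (\<integral>\<^sup>+z\<in>ball x r. ennreal (\<Phi> (K * w n z)) \<partial>lebesgue)"
      proof (rule nn_integral_mono)
        fix z
        show "ennreal (\<Phi> (K * (\<delta> / 2))) * indicator (E \<inter> ball x \<rho>) z
            \<le> ennreal (\<Phi> (K * w n z)) * indicator (ball x r) z"
        proof (cases "z \<in> E \<inter> ball x \<rho>")
          case True
          have "\<Phi> (K * (\<delta> / 2)) \<le> \<Phi> \<bar>K * w n z\<bar>"
            using True assms by (intro increasing) (auto simp: E_def abs_mult)
          then show ?thesis using True \<rho> by (auto simp: indicator_def ennreal_leI)
        qed auto
      qed
      also have "\<dots> \<le> (SUP y. \<integral>\<^sup>+x\<in>ball y r. ennreal (\<Phi> (K * w n x)) \<partial>lebesgue)"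
        by (rule SUP_upper) simp
      also have "\<dots> \<le> ennreal (\<Phi> (K * (\<delta> / 2))) * ennreal b"
        using elim b by (simp add: ennreal_mult less_imp_le)
      finally show ?thesis
        using p by (subst (asm) ennreal_mult_le_mult_iff) auto
    qed
    have "emeasure lebesgue {x. \<delta> < \<bar>w n x\<bar>} \<le> ennreal (1 / (1 / e))"
    proof (rule emeasure_level_le[OF wm])
      fix x assume x: "\<delta> < \<bar>w n x\<bar>"
      have "ennreal (1 / e) \<le> ennreal (?\<omega> / 2 * \<Phi> (\<delta> / 2 / \<rho> powr s))"
        using big by (rule ennreal_leI)
      also have "\<dots> \<le> inner_energy s (w n) x"
      proof (rule inner_energy_lower[OF E])
        show "emeasure lebesgue (E \<inter> ball x \<rho>) \<le> ennreal (?\<omega> * \<rho> ^ CARD('n) / 2)"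
          using small by (simp add: b_def)
        show "\<delta> / 2 \<le> \<bar>w n x - w n y\<bar>" if "y \<notin> E" for y
        proof -
          have "\<bar>w n y\<bar> \<le> \<delta> / 2" using that by (simp add: E_def)
          then show ?thesis using x abs_triangle_ineq2[of "w n x" "w n y"] by linarith
        qed
      qed (use assms \<rho> in auto)
      finally show "ennreal (1 / e) \<le> inner_energy s (w n) x" .
    qed (use e w in \<open>auto simp: unit_modular_def\<close>)
    also have "\<dots> < c" using c' e by simp
    finally show ?case .
  qed
qed auto

text \<open>One half of \<eta> pays for the small values through \<Phi>, the other for the large
  values through the energy. Intermediate values are bounded by a constant times the measure of the
  level set. Both \<delta> and \<open>C\<close> are uniform in \<open>w\<close>.\<close>

lemma subcritical_modular:
  assumes s: "0 < s" "s / real CARD('n) * m < 1"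
    and \<Psi>: "N_function \<Psi>" and slower: "grows_essentially_slower \<Psi> (critical_function CARD('n) s \<Phi>)"
    and lim: "((\<lambda>t. \<Psi> t / \<Phi> t) \<longlongrightarrow> 0) (at 0)"
    and "0 < B" "0 < \<eta>"
  obtains \<delta> C where "0 < \<delta>"
    and "\<And>w :: real^'n \<Rightarrow> real. unit_modular s w \<Longrightarrow>
      (\<integral>\<^sup>+x. ennreal (\<Psi> (B * \<bar>w x\<bar>)) \<partial>lebesgue)
        \<le> ennreal \<eta> + ennreal C * emeasure lebesgue {x. \<delta> < \<bar>w x\<bar>}"
proof -
  have nonneg\<Psi>: "0 \<le> \<Psi> t" for t using \<Psi> by (simp add: N_function_def)
  \<comment> \<open>The value at 0 follows from continuity and the limit of \<Psi>(t) / t;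
    monotonicity then follows by convexity on the segment from 0 to \<open>y\<close>.\<close>
  have \<Psi>0: "\<Psi> 0 = 0"
  proof -
    have "isCont \<Psi> 0" using \<Psi> by (auto simp: N_function_def continuous_on_eq_continuous_at)
    then have "(\<Psi> \<longlongrightarrow> \<Psi> 0) (at 0)" by (simp add: isCont_def)
    moreover have "(\<Psi> \<longlongrightarrow> 0) (at 0)"
    proof -
      have "((\<lambda>t. \<Psi> t / t * t) \<longlongrightarrow> 0 * 0) (at 0)"
        using \<Psi> by (intro tendsto_mult) (auto simp: N_function_def)
      then have "((\<lambda>t. \<Psi> t / t * t) \<longlongrightarrow> 0) (at 0)" by simp
      then show ?thesis
        by (rule Lim_transform_eventually) (simp add: eventually_at_filter)
    qed
    ultimately show ?thesis using tendsto_unique[of "at (0::real)" \<Psi>] by simp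
  qed
  have mono\<Psi>: "\<Psi> x \<le> \<Psi> y" if "0 \<le> x" "x \<le> y" for x y
  proof (cases "y = 0")
    case False
    then have y: "0 < y" using that by simp
    have "convex_on UNIV \<Psi>" using \<Psi> by (simp add: N_function_def)
    then have "\<Psi> ((1 - x / y) *\<^sub>R 0 + (x / y) *\<^sub>R y) \<le> (1 - x / y) * \<Psi> 0 + (x / y) * \<Psi> y"
      using that y by (intro convex_onD) auto
    then have "\<Psi> x \<le> (x / y) * \<Psi> y" using y \<Psi>0 by simp
    also have "\<dots> \<le> 1 * \<Psi> y" using that y nonneg\<Psi> by (intro mult_right_mono) auto
    finally show ?thesis by simp
  qed (use that in auto)
  obtain C0 where C0: "0 < C0"
    and strong: "\<And>(w :: real^'n \<Rightarrow> real) x v a. unit_modular s w \<Longrightarrow> 2 < \<bar>w x\<bar> \<Longrightarrow> 0 \<le> v \<Longrightarrow> 0 < a \<Longrightarrow> a \<le> 1 / 8 \<Longrightarrow>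
           v \<le> 2 * \<Phi> (2 * (a * \<bar>w x\<bar>) * v powr (s / real CARD('n))) \<Longrightarrow>
           ennreal v \<le> ennreal (a * C0) * inner_energy s w x"
    using strong_type[OF s] by blast
  \<comment> \<open>The first entry is the restriction of \<open>strong_type\<close>; the second
    gives \<open>a * C0 \<le> \<eta> / 2\<close>.\<close>
  define a where "a = min (1 / 8) (\<eta> / 2 / C0)"
  have a: "0 < a" "a \<le> 1 / 8" using C0 \<open>0 < \<eta>\<close> by (auto simp: a_def)
  have "a \<le> \<eta> / 2 / C0" by (simp add: a_def)
  then have aC: "a * C0 \<le> \<eta> / 2" using C0 by (simp add: field_simps)
  \<comment> \<open>The scale \<open>a / B\<close>, evaluated at \<open>B * \<bar>w x\<bar>\<close>,
    produces the argument \<open>a * \<bar>w x\<bar>\<close>.\<close>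
  obtain x0 where x0: "\<And>x. x0 \<le> x \<Longrightarrow> \<Psi> x \<le> critical_function CARD('n) s \<Phi> (a / B * x)"
    using slower a \<open>0 < B\<close> unfolding grows_essentially_slower_def by (metis divide_pos_pos)
  \<comment> \<open>Above \<open>T\<close> both \<open>strong_type\<close> and the comparison with
    \<open>\<Phi>\<^sub>*\<close> are available.\<close>
  define T where "T = max 2 (x0 / B)"
  \<comment> \<open>The divisor compensates the cost of replacing \<open>\<Phi> (B * t)\<close> by
    \<open>\<Phi> t\<close>.\<close>
  define \<epsilon> where "\<epsilon> = \<eta> / 2 / max 1 B powr m"
  have \<epsilon>: "0 < \<epsilon>" using \<open>0 < \<eta>\<close> by (simp add: \<epsilon>_def)
  have "\<forall>\<^sub>F t in at 0. \<Psi> t / \<Phi> t < \<epsilon>" using lim \<epsilon> by (rule order_tendstoD(2))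
  then obtain d where d: "0 < d" "\<And>t. t \<noteq> 0 \<Longrightarrow> \<bar>t\<bar> < d \<Longrightarrow> \<Psi> t / \<Phi> t < \<epsilon>"
    by (auto simp: eventually_at dist_real_def)
  define \<delta> where "\<delta> = d / (2 * B)"
  have \<delta>: "0 < \<delta>" using d \<open>0 < B\<close> by (simp add: \<delta>_def)
  have small: "\<Psi> (B * t) \<le> \<eta> / 2 * \<Phi> t" if "0 \<le> t" "t \<le> \<delta>" for t
  proof (cases "t = 0")
    case False
    then have t: "0 < B * t" using that \<open>0 < B\<close> by simp
    have "t < d / B" using that d \<open>0 < B\<close> by (simp add: \<delta>_def field_simps)
    then have "\<bar>B * t\<bar> < d" using t \<open>0 < B\<close> by (simp add: field_simps)
    then have "\<Psi> (B * t) \<le> \<epsilon> * \<Phi> (B * t)"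
      using d(2)[OF less_imp_neq[OF t, symmetric]] pos[OF t] by (simp only: pos_divide_less_eq less_imp_le)
    also have "\<dots> \<le> \<epsilon> * (max 1 B powr m * \<Phi> t)"
      using \<epsilon> \<open>0 < B\<close> by (intro mult_left_mono upper_max) auto
    also have "\<dots> = \<eta> / 2 * \<Phi> t" by (simp add: \<epsilon>_def)
    finally show ?thesis .
  qed (simp add: \<Psi>0 zero)
  have "(\<integral>\<^sup>+x. ennreal (\<Psi> (B * \<bar>w x\<bar>)) \<partial>lebesgue)
        \<le> ennreal \<eta> + ennreal (\<Psi> (B * T)) * emeasure lebesgue {x. \<delta> < \<bar>w x\<bar>}"
    if w: "unit_modular s w" for w :: "real^'n \<Rightarrow> real"
  proof -
    have wm [measurable]: "w \<in> borel_measurable lebesgue"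
      using w by (simp add: unit_modular_def)
    note inner_energy_measurable[OF wm, measurable]
    note level_set_lebesgue[OF wm, measurable]
    have "(\<integral>\<^sup>+x. ennreal (\<Psi> (B * \<bar>w x\<bar>)) \<partial>lebesgue) \<le>
      (\<integral>\<^sup>+x. ennreal (\<eta> / 2) * ennreal (\<Phi> (w x)) + ennreal (\<eta> / 2) * inner_energy s w x
         + ennreal (\<Psi> (B * T)) * indicator {x. \<delta> < \<bar>w x\<bar>} x \<partial>lebesgue)"
    proof (rule nn_integral_mono)
      fix x
      consider "\<bar>w x\<bar> \<le> \<delta>" | "\<delta> < \<bar>w x\<bar>" "\<bar>w x\<bar> \<le> T" | "T < \<bar>w x\<bar>" by linarith
      then show "ennreal (\<Psi> (B * \<bar>w x\<bar>)) \<le> ennreal (\<eta> / 2) * ennreal (\<Phi> (w x))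
          + ennreal (\<eta> / 2) * inner_energy s w x
          + ennreal (\<Psi> (B * T)) * indicator {x. \<delta> < \<bar>w x\<bar>} x"
      proof cases
        case 1
        then have "ennreal (\<Psi> (B * \<bar>w x\<bar>)) \<le> ennreal (\<eta> / 2) * ennreal (\<Phi> (w x))"
          using small[of "\<bar>w x\<bar>"] \<open>0 < \<eta>\<close> by (simp add: ennreal_mult[symmetric] ennreal_leI)
        then show ?thesis by (simp add: add_increasing2 add.assoc)
      next
        case 2
        then have "\<Psi> (B * \<bar>w x\<bar>) \<le> \<Psi> (B * T)"
          using \<open>0 < B\<close> by (intro mono\<Psi>) auto
        then show ?thesis using 2 by (simp add: add_increasing ennreal_leI)
      next
        case 3
        let ?v = "critical_function CARD('n) s \<Phi> (a * \<bar>w x\<bar>)"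
        have "x0 \<le> B * \<bar>w x\<bar>" using 3 \<open>0 < B\<close> by (simp add: T_def field_simps)
        then have "\<Psi> (B * \<bar>w x\<bar>) \<le> ?v" using x0[of "B * \<bar>w x\<bar>"] \<open>0 < B\<close> by simp
        then have "ennreal (\<Psi> (B * \<bar>w x\<bar>)) \<le> ennreal ?v" by (rule ennreal_leI)
        also have "\<dots> \<le> ennreal (a * C0) * inner_energy s w x"
          using 3 a s critical_function_bound[of "CARD('n)" s "a * \<bar>w x\<bar>"]
          by (intro strong[OF w]) (auto simp: T_def)
        also have "\<dots> \<le> ennreal (\<eta> / 2) * inner_energy s w x"
          using aC by (intro mult_right_mono ennreal_leI) auto
        finally show ?thesis by (simp add: add_increasing add_increasing2 add.assoc)
      qed
    qed
    also have "\<dots> = ennreal (\<eta> / 2) * (\<integral>\<^sup>+x. ennreal (\<Phi> (w x)) \<partial>lebesgue)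
        + ennreal (\<eta> / 2) * (\<integral>\<^sup>+x. inner_energy s w x \<partial>lebesgue)
        + ennreal (\<Psi> (B * T)) * emeasure lebesgue {x. \<delta> < \<bar>w x\<bar>}"
      by (simp add: nn_integral_add nn_integral_cmult nn_integral_cmult_indicator)
    also have "\<dots> \<le> ennreal (\<eta> / 2) * 1 + ennreal (\<eta> / 2) * 1
        + ennreal (\<Psi> (B * T)) * emeasure lebesgue {x. \<delta> < \<bar>w x\<bar>}"
      using w by (intro add_mono mult_left_mono) (auto simp: unit_modular_def)
    also have "ennreal (\<eta> / 2) * 1 + ennreal (\<eta> / 2) * 1 = ennreal \<eta>"
      using \<open>0 < \<eta>\<close> by (simp add: ennreal_plus[symmetric] del: ennreal_plus)
    finally show ?thesis .
  qed
  then show ?thesis using that \<delta> by blast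
qed

end

theorem theorem1p6:
  fixes s r :: real
    and \<phi> \<Psi> :: "real \<Rightarrow> real"
    and V :: "real^'n \<Rightarrow> real"
    and u :: "nat \<Rightarrow> real^'n \<Rightarrow> real"
  assumes "0 < s" and "s < 1" and "2 * s < real CARD('n)"
    and "\<phi> C1_differentiable_on UNIV"
    and "\<And>t. Phi \<phi> (- t) = Phi \<phi> t"
    and "phi_1 \<phi>" and "phi_2 \<phi>" and "phi_3 CARD('n) \<phi>"
    and "V \<in> borel_measurable lebesgue" and "\<And>x. 0 \<le> V x"
    and "N_function \<Psi>"
    and "grows_essentially_slower \<Psi> (critical_function CARD('n) s (Phi \<phi>))"
    and "((\<lambda>t. \<Psi> t / Phi \<phi> t) \<longlongrightarrow> 0) (at 0)"
    and "\<And>n. u n \<in> W_space s (Phi \<phi>)"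
    and "\<exists>C. \<forall>n. W_norm s (Phi \<phi>) (u n) \<le> C"
    and "weakly_converges_on (X_space s (Phi \<phi>) V) (X_norm s (Phi \<phi>) V) u (\<lambda>x. 0)"
    and "0 < r"
    and "(\<lambda>n. SUP y. \<integral>\<^sup>+x\<in>ball y r. ennreal (Phi \<phi> (u n x)) \<partial>lebesgue) \<longlonglongrightarrow> 0"
  shows "(\<forall>n. u n \<in> L_space \<Psi>) \<and> (\<lambda>n. L_norm \<Psi> (u n)) \<longlonglongrightarrow> 0"
proof -
  obtain m where gf: "growth_function (Phi \<phi>) m" and m: "m < real CARD('n)"
    using growth_function_Phi[OF assms(4-8)] by blast
  interpret growth_function "Phi \<phi>" m by (rule gf)
  have "s * m < 1 * real CARD('n)"
    using assms(1,2) m m_pos by (intro mult_strict_mono) auto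
  then have \<sigma>: "s / real CARD('n) * m < 1" by (simp add: field_simps)
  have um [measurable]: "u n \<in> borel_measurable lebesgue" for n
    using assms(14) by (simp add: W_space_def L_space_def)
  have Dm [measurable]: "D_quot s (u n) \<in> borel_measurable mu" for n
    using D_quot_measurable[OF um] by (simp add: mu_def)
  define S1 where "S1 n = {k. 0 < k \<and> (\<integral>\<^sup>+x. ennreal (Phi \<phi> (\<bar>u n x\<bar> / k)) \<partial>lebesgue) \<le> 1}" for n
  define S2 where "S2 n = {k. 0 < k \<and> (\<integral>\<^sup>+z. ennreal (Phi \<phi> (\<bar>D_quot s (u n) z\<bar> / k)) \<partial>mu) \<le> 1}" for n
  have ne: "S1 n \<noteq> {}" "S2 n \<noteq> {}" for n
    unfolding S1_def S2_def using assms(14)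
    by (intro luxemburg_nonempty um Dm; simp add: W_space_def L_space_def)+
  have Inf0: "0 \<le> Inf (S1 n)" "0 \<le> Inf (S2 n)" for n
    using ne by (auto intro!: Inf_pos_nonneg simp: S1_def S2_def)
  obtain C where C: "\<And>n. W_norm s (Phi \<phi>) (u n) \<le> C" using assms(15) by blast
  have norm_eq: "W_norm s (Phi \<phi>) (u n) = Inf (S1 n) + Inf (S2 n)" for n
    by (simp add: W_norm_def L_norm_def W_seminorm_def S1_def S2_def)
  \<comment> \<open>Each infimum is nonnegative and their sum is at most \<open>C\<close>, so both
    lie strictly below \<open>K\<close>, as \<open>luxemburg_modular\<close> requires.\<close>
  define K where "K = C + 1"
  have InfK: "Inf (S1 n) < K" "Inf (S2 n) < K" for n
    using C[of n] Inf0[of n] by (auto simp: K_def norm_eq)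
  have K: "0 < K" using InfK(1)[of 0] Inf0(1)[of 0] by linarith
  define w where "w n = (\<lambda>x. u n x / K)" for n
  have uw: "u n x = K * w n x" for n x using K by (simp add: w_def)
  have w: "unit_modular s (w n)" for n
    unfolding unit_modular_def
  proof (intro conjI)
    show wm: "w n \<in> borel_measurable lebesgue" by (simp add: w_def)
    show "(\<integral>\<^sup>+x. ennreal (Phi \<phi> (w n x)) \<partial>lebesgue) \<le> 1"
      unfolding w_def by (rule luxemburg_modular[OF S1_def ne(1) InfK(1)])
    have "D_quot s (w n) z = D_quot s (u n) z / K" for z
      by (cases z) (simp add: D_quot_def w_def diff_divide_distrib[symmetric])
    then show "(\<integral>\<^sup>+x. inner_energy s (w n) x \<partial>lebesgue) \<le> 1"
      using luxemburg_modular[OF S2_def ne(2) InfK(2), of n]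
      by (simp add: nn_integral_mu[OF wm, symmetric])
  qed
  have level: "(\<lambda>n. emeasure lebesgue {x. \<delta> < \<bar>w n x\<bar>}) \<longlonglongrightarrow> 0" if "0 < \<delta>" for \<delta>
    by (rule vanishing_level[OF w assms(1) K assms(17) that assms(18)[unfolded uw]])
  note est = subcritical_modular[OF assms(1) \<sigma> assms(11-13)]
  \<comment> \<open>With \<eta> = 1 the modular is finite, since the level set has finite measure by
    Chebyshev's inequality.\<close>
  have "u n \<in> L_space \<Psi>" for n
  proof -
    obtain \<delta> C where "0 < \<delta>" and bd: "\<And>w :: real^'n \<Rightarrow> real. unit_modular s w \<Longrightarrow>
      (\<integral>\<^sup>+x. ennreal (\<Psi> (K * \<bar>w x\<bar>)) \<partial>lebesgue)
        \<le> ennreal 1 + ennreal C * emeasure lebesgue {x. \<delta> < \<bar>w x\<bar>}"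
      using est[OF K zero_less_one] by blast
    have "(\<integral>\<^sup>+x. ennreal (\<Psi> \<bar>u n x\<bar>) \<partial>lebesgue) = (\<integral>\<^sup>+x. ennreal (\<Psi> (K * \<bar>w n x\<bar>)) \<partial>lebesgue)"
      using K by (simp add: uw abs_mult)
    also note bd[OF w]
    also have "ennreal 1 + ennreal C * emeasure lebesgue {x. \<delta> < \<bar>w n x\<bar>}
        \<le> ennreal 1 + ennreal C * ennreal (1 / Phi \<phi> \<delta>)"
      by (intro add_left_mono mult_left_mono unit_modular_level[OF w \<open>0 < \<delta>\<close>]) simp
    also have "\<dots> < \<infinity>" by (simp add: ennreal_mult_less_top)
    finally have "(\<integral>\<^sup>+x. ennreal (\<Psi> \<bar>u n x\<bar>) \<partial>lebesgue) < \<infinity>" .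
    then show ?thesis by (simp add: L_space_def)
  qed
  moreover have "(\<lambda>n. L_norm \<Psi> (u n)) \<longlonglongrightarrow> 0"
  proof (rule tendstoI)
    fix e :: real assume "0 < e"
    \<comment> \<open>It suffices that \<epsilon> is eventually admissible in the Luxemburg infimum,
      that is, that \<Psi> of \<open>K / \<epsilon> * \<bar>w n x\<bar>\<close> has integral at most
      1. One half comes from \<eta>, the other from the vanishing level sets.\<close>
    define \<epsilon> where "\<epsilon> = e / 2"
    have \<epsilon>: "0 < \<epsilon>" "\<epsilon> < e" using \<open>0 < e\<close> by (auto simp: \<epsilon>_def)
    have B: "0 < K / \<epsilon>" using K \<epsilon> by simp
    obtain \<delta> C where "0 < \<delta>" and bd: "\<And>w :: real^'n \<Rightarrow> real. unit_modular s w \<Longrightarrow>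
      (\<integral>\<^sup>+x. ennreal (\<Psi> (K / \<epsilon> * \<bar>w x\<bar>)) \<partial>lebesgue)
        \<le> ennreal (1 / 2) + ennreal C * emeasure lebesgue {x. \<delta> < \<bar>w x\<bar>}"
      using est[OF B half_gt_zero[OF zero_less_one]] by blast
    have "(\<lambda>n. ennreal C * emeasure lebesgue {x. \<delta> < \<bar>w n x\<bar>}) \<longlonglongrightarrow> ennreal C * 0"
      using level[OF \<open>0 < \<delta>\<close>] by (intro ennreal_tendsto_cmult) auto
    then have "\<forall>\<^sub>F n in sequentially. ennreal C * emeasure lebesgue {x. \<delta> < \<bar>w n x\<bar>} < ennreal (1 / 2)"
      by (rule order_tendstoD(2)) (simp only: mult_zero_right ennreal_less_zero_iff half_gt_zero zero_less_one)
    then show "\<forall>\<^sub>F n in sequentially. dist (L_norm \<Psi> (u n)) 0 < e"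
    proof eventually_elim
      case (elim n)
      let ?S = "{k. 0 < k \<and> (\<integral>\<^sup>+x. ennreal (\<Psi> (\<bar>u n x\<bar> / k)) \<partial>lebesgue) \<le> 1}"
      have "(\<integral>\<^sup>+x. ennreal (\<Psi> (\<bar>u n x\<bar> / \<epsilon>)) \<partial>lebesgue) = (\<integral>\<^sup>+x. ennreal (\<Psi> (K / \<epsilon> * \<bar>w n x\<bar>)) \<partial>lebesgue)"
        using K by (simp add: uw abs_mult)
      also have "\<dots> \<le> ennreal (1 / 2) + ennreal (1 / 2)"
        by (rule order_trans[OF bd[OF w] add_left_mono[OF less_imp_le[OF elim]]])
      also have "\<dots> = ennreal (1 / 2 + 1 / 2)" by (rule ennreal_plus[symmetric]) auto
      also have "\<dots> = 1" by simp
      finally have mem: "\<epsilon> \<in> ?S" using \<epsilon> by simp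
      have "Inf ?S \<le> \<epsilon>"
        by (rule cInf_lower[OF mem]) (auto intro: bdd_belowI[of _ 0] less_imp_le)
      moreover have "0 \<le> Inf ?S"
        using mem by (intro Inf_pos_nonneg) auto
      ultimately show ?case using \<epsilon> by (simp add: L_norm_def)
    qed
  qed
  ultimately show ?thesis by blast
qed

end
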